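(* Let $d\ge 2$ and consider the annealed Ising model on the random $d$-regular (multi)graph with $n$ vertices. Suppose that $\beta>\beta_c$ and $B=0$. Then there exists a constant $\nu=\nu(\beta)>0$ such that, as $n\to\infty$, $$\mu_n\left(\left|\frac{S_n}{n}-\nu\right|\le n^{-1/6}\right)\longrightarrow\frac12\qquad\text{and}\qquad\mu_n\left(\left|\frac{S_n}{n}+\nu\right|\le n^{-1/6}\right)\longrightarrow\frac12.$$
   Context: Random $d$-regular graph $G_{n,d}$ (configuration model): attach $d$ half-edges to each of the vertices $v_1,\dots,v_n$ and pair all half-edges by a uniformly random perfect matching, each pair forming an edge; self-loops and multiple edges are allowed. The total number of half-edges is assumed even (if $dn$ is odd, the degree of one vertex is increased by $1$). Ising model: let $k_{i,j}$ be the number of edges between $v_i$ and $v_j$ (for $i=j$, the number of self-loops at $v_i$), $\beta\ge 0$, $B\in\mathbb{R}$, $\Omega_n=\{-1,1\}^n$. For $\sigma\in\Omega_n$ put $$H(\sigma)=-\beta\sum_{i\le j}k_{i,j}\sigma_i\sigma_j-B\sum_{i=1}^n\sigma_i,\qquad Z_n(\beta,B)=\sum_{\sigma\in\Omega_n}e^{-H(\sigma)}.$$ With $\mathbb{E}$ the expectation over the random graph, the annealed measure on $\Omega_n$ is $\mu_n(\sigma)=\mathbb{E}(e^{-H(\sigma)})/\mathbb{E}(Z_n(\beta,B))$; $S_n=\sigma_1+\dots+\sigma_n$. With $\mathcal{M}(\beta,B)=\lim_n\mathbb{E}_{\mu_n}(S_n/n)$ (when it exists), the critical inverse temperature is $\beta_c=\inf\{\beta>0:\lim_{B\searrow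 0}\mathcal{M}(\beta,B)>0\}$, which equals $\operatorname{atanh}(1/(d-1))$ (so $\frac12\log\frac{d}{d-2}$ if $d\ge3$ and $\infty$ if $d=2$, in which case the statement is vacuous). *)

theory Defs
  imports "HOL-Probability.Probability"
begin

text \<open>
  Vertex \<open>v\<^sub>i\<close> is the natural number \<open>i \<in> {1..n}\<close>. If \<open>d * n\<close> is odd, the vertex of
  increased degree is \<open>v\<^sub>n\<close>; relabelling the vertices shows that the law of the total spin
  does not depend on this choice.
\<close>

definition vertex_degree :: "nat \<Rightarrow> nat \<Rightarrow> nat \<Rightarrow> nat" where
  "vertex_degree d n i = (if i = n \<and> odd (d * n) then d + 1 else d)"

definition half_edges :: "nat \<Rightarrow> nat \<Rightarrow> (nat \<times> nat) set" where
  "half_edges d n = (SIGMA i:{1..n}. {..<vertex_degree d n i})"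

definition perfect_matchings :: "'a set \<Rightarrow> 'a set set set" where
  "perfect_matchings A = {M. partition_on A M \<and> (\<forall>e\<in>M. card e = 2)}"

definition configuration_model :: "nat \<Rightarrow> nat \<Rightarrow> (nat \<times> nat) set set pmf" where
  "configuration_model d n = pmf_of_set (perfect_matchings (half_edges d n))"

text \<open>For \<open>i = j\<close> this counts the pairs with both half-edges at \<open>v\<^sub>i\<close>, each self-loop once.\<close>

definition edge_count :: "(nat \<times> nat) set set \<Rightarrow> nat \<Rightarrow> nat \<Rightarrow> nat" where
  "edge_count M i j = card {e \<in> M. fst ` e = {i, j}}"

definition spin_configs :: "nat \<Rightarrow> (nat \<Rightarrow> real) set" where
  "spin_configs n = ({1..n} \<rightarrow>\<^sub>E {-1, 1})"

definition total_spin :: "nat \<Rightarrow> (nat \<Rightarrow> real) \<Rightarrow> real" where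
  "total_spin n \<sigma> = (\<Sum>i=1..n. \<sigma> i)"

definition hamiltonian ::
    "nat \<Rightarrow> real \<Rightarrow> real \<Rightarrow> (nat \<times> nat) set set \<Rightarrow> (nat \<Rightarrow> real) \<Rightarrow> real" where
  "hamiltonian n \<beta> B M \<sigma> =
     - \<beta> * (\<Sum>i=1..n. \<Sum>j=i..n. real (edge_count M i j) * \<sigma> i * \<sigma> j) - B * (\<Sum>i=1..n. \<sigma> i)"

definition partition_function :: "nat \<Rightarrow> real \<Rightarrow> real \<Rightarrow> (nat \<times> nat) set set \<Rightarrow> real" where
  "partition_function n \<beta> B M = (\<Sum>\<sigma>\<in>spin_configs n. exp (- hamiltonian n \<beta> B M \<sigma>))"

definition annealed_weight :: "nat \<Rightarrow> nat \<Rightarrow> real \<Rightarrow> real \<Rightarrow> (nat \<Rightarrow> real) \<Rightarrow> real" where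
  "annealed_weight d n \<beta> B \<sigma> =
     measure_pmf.expectation (configuration_model d n) (\<lambda>M. exp (- hamiltonian n \<beta> B M \<sigma>)) /
     measure_pmf.expectation (configuration_model d n) (\<lambda>M. partition_function n \<beta> B M)"

definition annealed_measure :: "nat \<Rightarrow> nat \<Rightarrow> real \<Rightarrow> real \<Rightarrow> (nat \<Rightarrow> real) measure" where
  "annealed_measure d n \<beta> B =
     point_measure (spin_configs n) (\<lambda>\<sigma>. ennreal (annealed_weight d n \<beta> B \<sigma>))"

definition finite_magnetization :: "nat \<Rightarrow> real \<Rightarrow> real \<Rightarrow> nat \<Rightarrow> real" where
  "finite_magnetization d \<beta> B n =
     (LINT \<sigma>|annealed_measure d n \<beta> B. total_spin n \<sigma> / real n)"

text \<open>Meaningful only when the limit exists.\<close>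

definition magnetization :: "nat \<Rightarrow> real \<Rightarrow> real \<Rightarrow> real" where
  "magnetization d \<beta> B = lim (\<lambda>n. finite_magnetization d \<beta> B n)"

text \<open>
  The spontaneous magnetization is positive: both the limit over \<open>n\<close>, for all small
  \<open>B > 0\<close>, and the limit as \<open>B\<close> decreases to \<open>0\<close> are required to exist.
\<close>

definition spontaneously_magnetized :: "nat \<Rightarrow> real \<Rightarrow> bool" where
  "spontaneously_magnetized d \<beta> \<longleftrightarrow>
     (\<forall>\<^sub>F B in at_right 0. convergent (\<lambda>n. finite_magnetization d \<beta> B n)) \<and>
     (\<exists>m>0. ((\<lambda>B. magnetization d \<beta> B) \<longlongrightarrow> m) (at_right 0))"

text \<open>Extended real, so that the infimum of the empty set (as for \<open>d = 2\<close>) is \<open>\<infinity>\<close>.\<close>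

definition critical_beta :: "nat \<Rightarrow> ereal" where
  "critical_beta d = Inf (ereal ` {\<beta>. \<beta> > 0 \<and> spontaneously_magnetized d \<beta>})"

end

theory Submission
  imports Defs "HOL-Real_Asymp.Real_Asymp"
begin

text \<open>
  The sum over all pairings of the half-edges is a Gaussian moment in disguise, and averaging over
  the graph reduces the model to independent spins in a common random environment. Put
  \<open>q = exp (- 2 * \<beta>) = cos (2 * \<alpha>)\<close>. Up to a factor that does not depend on \<open>\<sigma>\<close>, a pairing has
  weight \<open>q\<close> for each edge joining opposite spins. Choosing the partner of one half-edge gives a
  recursion for the sum of these weights over all pairings, and integration by parts gives the same
  recursion for the integral over the circle of the product of \<open>cos (t - \<sigma> i * \<alpha>)\<close> over all
  half-edges (\<open>circle_integral_recursion\<close>, \<open>matching_sum_eq_circle_integral\<close>). Hence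
  \<open>\<mu>\<^sub>n(\<sigma>)\<close> is proportional to the integral over \<open>t\<close> of the product over the vertices of
  \<open>cos (t - \<sigma> i * \<alpha>) ^ d\<close>: for each angle \<open>t\<close> the spins are independent, with (possibly signed)
  weights \<open>X ^ d\<close> and \<open>Y ^ d\<close> (for odd \<open>d * n\<close>, one vertex has exponent \<open>d + 1\<close>), where \<open>X = cos (t - \<alpha>)\<close> and \<open>Y = cos (t + \<alpha>)\<close>.

  This leaves a one-dimensional Laplace problem for \<open>\<bar>X\<bar> ^ d + \<bar>Y\<bar> ^ d\<close>. The points \<open>(X, Y)\<close> lie on
  the ellipse \<open>X\<^sup>2 + Y\<^sup>2 - 2 * q * X * Y = 1 - q\<^sup>2\<close>, so with
  \<open>w = \<bar>\<bar>X\<bar> - \<bar>Y\<bar>\<bar> / (\<bar>X\<bar> + \<bar>Y\<bar>)\<close> the logarithm of this sum is, up to a constant, at most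
  \<open>ln ((1 + w) ^ d + (1 - w) ^ d) - d / 2 * ln (1 - q + (1 + q) * w\<^sup>2)\<close> (the function \<open>rate\<close>), with
  equality if \<open>X\<close> and \<open>Y\<close> have the same sign. The derivative of \<open>rate\<close> has the sign of an odd
  polynomial whose coefficients change sign at most once. If \<open>(d - 1) * (1 - q) < 1 + q\<close>, that is,
  below the critical value, all coefficients are nonpositive and the maximum is at \<open>w = 0\<close>; above
  it, there is exactly one maximum \<open>u > 0\<close>. In both cases \<open>rate\<close> drops quadratically away from
  its maximum (\<open>rate_max_subcritical\<close>, \<open>rate_max_supercritical\<close>).

  For fixed \<open>t\<close>, Hoeffding's inequality concentrates \<open>S\<^sub>n / n\<close> around the bias of a single spin.
  Together with the quadratic drop and a lower bound of order \<open>1 / n\<close> times the leading exponential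
  for the partition function, this shows that \<open>\<bar>S\<^sub>n / n\<bar>\<close> differs from \<open>\<nu>\<close> by more than \<open>\<epsilon>\<close> with
  probability at most \<open>C * n * exp (- c * n * \<epsilon>\<^sup>2)\<close> (\<open>off_target_tilted\<close>). Here \<open>\<nu>\<close> is \<open>0\<close> in the
  subcritical case and positive in the supercritical case.

  In the subcritical case a field \<open>B\<close> changes probabilities by at most a factor \<open>exp (2 * B * n)\<close>,
  so for small \<open>B\<close> the magnetization remains small, and there is no spontaneous magnetization
  (\<open>not_spontaneously_magnetized\<close>). Therefore every \<open>\<beta>\<close> above \<open>critical_beta d\<close> is supercritical:
  some smaller \<open>\<beta>'\<close> is magnetized, hence not subcritical, and the condition is strictly monotone in
  \<open>\<beta>\<close>. There \<open>\<epsilon> = n powr (- 1 / 6)\<close> makes the error \<open>C * n * exp (- c * n powr (2 / 3))\<close> vanish, and the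
  symmetry under a global spin flip gives the masses \<open>1 / 2\<close>.
\<close>

section \<open>Perfect matchings and circle integrals\<close>

lemma finite_perfect_matchings: "finite A \<Longrightarrow> finite (perfect_matchings A)"
  unfolding perfect_matchings_def
  by (rule finite_subset[OF _ finitely_many_partition_on]) auto

lemma perfect_matchings_empty: "perfect_matchings {} = {{}}"
  by (auto simp: perfect_matchings_def partition_on_empty)

text \<open>A perfect matching is determined by the partner of one fixed element and a perfect matching of the rest.\<close>

lemma perfect_matchings_decompose:
  assumes "a \<in> A"
  shows "perfect_matchings A = (\<Union>b\<in>A - {a}. insert {a, b} ` perfect_matchings (A - {a, b}))"
proof (intro equalityI subsetI)
  fix M assume "M \<in> perfect_matchings A"
  then have part: "partition_on A M" and two: "\<And>e. e \<in> M \<Longrightarrow> card e = 2"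
    by (auto simp: perfect_matchings_def)
  from part \<open>a \<in> A\<close> obtain e where e: "e \<in> M" "a \<in> e"
    by (auto simp: partition_on_def)
  obtain b where b: "e = {a, b}" "b \<noteq> a"
    using two[OF e(1)] e(2) by (auto simp: card_2_iff)
  have disj: "disjnt e (\<Union>(M - {e}))"
    using part e(1) by (auto simp: partition_on_def pairwise_def disjnt_def)
  have "partition_on A (insert e (M - {e}))"
    using part e(1) by (simp add: insert_absorb)
  then have "partition_on (A - e) (M - {e})" and "e \<subseteq> A"
    using partition_on_insert[OF disj] by auto
  with b two have "M - {e} \<in> perfect_matchings (A - {a, b})" "b \<in> A - {a}"
    by (auto simp: perfect_matchings_def)
  moreover have "M = insert {a, b} (M - {e})"
    using e(1) b(1) by auto
  ultimately show "M \<in> (\<Union>b\<in>A - {a}. insert {a, b} ` perfect_matchings (A - {a, b}))"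
    by blast
next
  fix M assume "M \<in> (\<Union>b\<in>A - {a}. insert {a, b} ` perfect_matchings (A - {a, b}))"
  then obtain b M' where b: "b \<in> A" "b \<noteq> a" and M': "M' \<in> perfect_matchings (A - {a, b})"
    and M: "M = insert {a, b} M'"
    by auto
  have part: "partition_on (A - {a, b}) M'" and two: "\<And>e. e \<in> M' \<Longrightarrow> card e = 2"
    using M' by (auto simp: perfect_matchings_def)
  have "disjnt {a, b} (\<Union>M')"
    using partition_onD1[OF part] by (auto simp: disjnt_def)
  then have "partition_on A M"
    using partition_on_insert[of "{a, b}" M' A] part b \<open>a \<in> A\<close> M by auto
  with two b M show "M \<in> perfect_matchings A"
    by (auto simp: perfect_matchings_def)
qed

lemma sum_perfect_matchings_rec:
  fixes w :: "'a set \<Rightarrow> real"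
  assumes "finite A" "a \<in> A"
  shows "(\<Sum>M\<in>perfect_matchings A. \<Prod>e\<in>M. w e) =
         (\<Sum>b\<in>A - {a}. w {a, b} * (\<Sum>M\<in>perfect_matchings (A - {a, b}). \<Prod>e\<in>M. w e))"
proof -
  have notin: "e \<notin> M" if "M \<in> perfect_matchings (A - {a, b})" "a \<in> e" for e M b
    using that by (auto simp: perfect_matchings_def partition_on_def)
  have inj: "inj_on (insert {a, b}) (perfect_matchings (A - {a, b}))" for b
    by (rule inj_onI) (metis insertI1 insert_ident notin)
  have disj: "insert {a, b} ` perfect_matchings (A - {a, b})
      \<inter> insert {a, c} ` perfect_matchings (A - {a, c}) = {}"
    if "b \<noteq> c" for b c
  proof -
    have "{a, b} \<noteq> {a, c}" using that by (auto simp: doubleton_eq_iff)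
    then have "insert {a, b} M \<noteq> insert {a, c} N"
      if "M \<in> perfect_matchings (A - {a, b})" "N \<in> perfect_matchings (A - {a, c})" for M N
      using notin[OF that(2), of "{a, b}"] by blast
    then show ?thesis by blast
  qed
  have fin: "finite M" if "M \<in> perfect_matchings (A - {a, b})" for M b
    using that assms(1) finite_elements[of "A - {a, b}" M] by (auto simp: perfect_matchings_def)
  have "(\<Sum>M\<in>perfect_matchings A. \<Prod>e\<in>M. w e) =
      (\<Sum>b\<in>A - {a}. \<Sum>M\<in>insert {a, b} ` perfect_matchings (A - {a, b}). \<Prod>e\<in>M. w e)"
    unfolding perfect_matchings_decompose[OF assms(2)]
    using assms(1) disj by (intro sum.UNION_disjoint) (auto intro!: finite_imageI finite_perfect_matchings)
  also have "\<dots> = (\<Sum>b\<in>A - {a}. w {a, b} * (\<Sum>M\<in>perfect_matchings (A - {a, b}). \<Prod>e\<in>M. w e))"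
  proof (rule sum.cong[OF refl])
    fix b
    have "(\<Sum>M\<in>insert {a, b} ` perfect_matchings (A - {a, b}). \<Prod>e\<in>M. w e) =
        (\<Sum>M\<in>perfect_matchings (A - {a, b}). \<Prod>e\<in>insert {a, b} M. w e)"
      by (simp add: sum.reindex[OF inj])
    also have "\<dots> = (\<Sum>M\<in>perfect_matchings (A - {a, b}). w {a, b} * (\<Prod>e\<in>M. w e))"
      using fin notin by (intro sum.cong) auto
    finally show "(\<Sum>M\<in>insert {a, b} ` perfect_matchings (A - {a, b}). \<Prod>e\<in>M. w e) =
        w {a, b} * (\<Sum>M\<in>perfect_matchings (A - {a, b}). \<Prod>e\<in>M. w e)"
      by (simp add: sum_distrib_left)
  qed
  finally show ?thesis .
qed

text \<open>
  This is the integral over a full period of the derivative of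
  \<open>\<lambda>t. sin (t - \<phi> a) * (\<Prod>h\<in>A - {a}. cos (t - \<phi> h))\<close>, which vanishes. The products of two sines are
  removed by \<open>sin (t - \<phi> a) * sin (t - \<phi> b) = cos (\<phi> a - \<phi> b) - cos (t - \<phi> a) * cos (t - \<phi> b)\<close>;
  each of the \<open>card A - 1\<close> elements \<open>b\<close> thereby contributes another copy of the full product.
\<close>

lemma circle_integral_recursion:
  fixes \<phi> :: "'a \<Rightarrow> real"
  assumes "finite A" "a \<in> A"
  shows "real (card A) * integral {0..2*pi} (\<lambda>t. \<Prod>h\<in>A. cos (t - \<phi> h)) =
         (\<Sum>b\<in>A - {a}. cos (\<phi> a - \<phi> b) *
            integral {0..2*pi} (\<lambda>t. \<Prod>h\<in>A - {a, b}. cos (t - \<phi> h)))"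
proof -
  let ?P = "\<lambda>S t. \<Prod>h\<in>S. cos (t - \<phi> h)"
  let ?D = "\<lambda>t. real (card A) * ?P A t - (\<Sum>b\<in>A - {a}. cos (\<phi> a - \<phi> b) * ?P (A - {a, b}) t)"
  have fin: "finite (A - {a})" and card: "real (card A) = 1 + real (card (A - {a}))"
    using assms card.remove[OF assms] by auto
  have deriv: "((\<lambda>t. sin (t - \<phi> a) * ?P (A - {a}) t) has_vector_derivative ?D t) (at t)" for t
  proof -
    have prod_a: "?P A t = cos (t - \<phi> a) * ?P (A - {a}) t"
      using assms by (simp add: prod.remove)
    have Pa: "((\<lambda>t. ?P (A - {a}) t) has_field_derivative
        (\<Sum>b\<in>A - {a}. - sin (t - \<phi> b) * ?P (A - {a} - {b}) t)) (at t)"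
      by (intro has_field_derivative_prod) (auto intro!: derivative_eq_intros)
    have sins: "sin (t - \<phi> a) * (- sin (t - \<phi> b) * ?P (A - {a} - {b}) t)
        = ?P A t - cos (\<phi> a - \<phi> b) * ?P (A - {a, b}) t" if "b \<in> A - {a}" for b
    proof -
      have "- (sin (t - \<phi> a) * sin (t - \<phi> b))
          = cos (t - \<phi> a) * cos (t - \<phi> b) - cos ((t - \<phi> b) - (t - \<phi> a))"
        by (simp only: cos_diff) (simp add: algebra_simps)
      moreover have "?P A t = cos (t - \<phi> a) * (cos (t - \<phi> b) * ?P (A - {a} - {b}) t)"
        using that fin by (simp add: prod_a prod.remove[of "A - {a}" b])
      moreover have "A - {a} - {b} = A - {a, b}" by auto
      ultimately show ?thesis
        by (simp add: algebra_simps)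
    qed
    have "cos (t - \<phi> a) * ?P (A - {a}) t
        + sin (t - \<phi> a) * (\<Sum>b\<in>A - {a}. - sin (t - \<phi> b) * ?P (A - {a} - {b}) t)
        = ?P A t + (\<Sum>b\<in>A - {a}. ?P A t - cos (\<phi> a - \<phi> b) * ?P (A - {a, b}) t)"
      unfolding sum_distrib_left prod_a[symmetric] using sins by (intro arg_cong2[of _ _ _ _ "(+)"] sum.cong) auto
    also have "\<dots> = ?D t"
      by (simp add: sum_subtractf card algebra_simps)
    finally have eq: "cos (t - \<phi> a) * ?P (A - {a}) t
        + sin (t - \<phi> a) * (\<Sum>b\<in>A - {a}. - sin (t - \<phi> b) * ?P (A - {a} - {b}) t) = ?D t" .
    have "((\<lambda>t. sin (t - \<phi> a)) has_field_derivative cos (t - \<phi> a)) (at t)"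
      by (auto intro!: derivative_eq_intros)
    from DERIV_mult[OF this Pa] show ?thesis
      unfolding eq[symmetric] has_real_derivative_iff_has_vector_derivative
      by (simp add: mult.commute)
  qed
  have "(?D has_integral (sin (2*pi - \<phi> a) * ?P (A - {a}) (2*pi)
      - sin (0 - \<phi> a) * ?P (A - {a}) 0)) {0..2*pi}"
    by (rule fundamental_theorem_of_calculus)
      (auto intro: has_vector_derivative_at_within deriv)
  moreover have "sin (2*pi - x) = sin (0 - x)" "cos (2*pi - x) = cos (0 - x)" for x :: real
    by (simp_all add: sin_diff cos_diff)
  ultimately have "integral {0..2*pi} ?D = 0"
    by (simp add: integral_unique)
  moreover have "integral {0..2*pi} ?D = real (card A) * integral {0..2*pi} (?P A)
      - integral {0..2*pi} (\<lambda>t. \<Sum>b\<in>A - {a}. cos (\<phi> a - \<phi> b) * ?P (A - {a, b}) t)"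
    using fin by (subst integral_diff) (auto intro!: integrable_continuous_real continuous_intros)
  moreover have "integral {0..2*pi} (\<lambda>t. \<Sum>b\<in>A - {a}. cos (\<phi> a - \<phi> b) * ?P (A - {a, b}) t)
      = (\<Sum>b\<in>A - {a}. cos (\<phi> a - \<phi> b) * integral {0..2*pi} (?P (A - {a, b})))"
    using fin by (subst integral_sum) (auto intro!: integrable_continuous_real continuous_intros)
  ultimately show ?thesis by simp
qed

text \<open>
  A form of Wick's formula: for a standard Gaussian vector in the plane, the covariance of its
  components in the directions \<open>\<phi> a\<close> and \<open>\<phi> b\<close> is \<open>cos (\<phi> a - \<phi> b)\<close>, and in polar coordinates the
  moment of a product of components is a radial constant times the integral on the right.
\<close>

theorem matching_sum_eq_circle_integral:
  fixes \<phi> :: "'a \<Rightarrow> real" and w :: "'a set \<Rightarrow> real"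
  assumes "finite A" "card A = 2 * m"
    and "\<And>a b. a \<in> A \<Longrightarrow> b \<in> A \<Longrightarrow> a \<noteq> b \<Longrightarrow> w {a, b} = \<kappa> * cos (\<phi> a - \<phi> b)"
  shows "(\<Sum>M\<in>perfect_matchings A. \<Prod>e\<in>M. w e) =
         (2 * \<kappa>) ^ m * fact m / (2 * pi) * integral {0..2*pi} (\<lambda>t. \<Prod>h\<in>A. cos (t - \<phi> h))"
  using assms
proof (induction m arbitrary: A)
  case 0
  then show ?case by (simp add: perfect_matchings_empty)
next
  case (Suc m)
  then obtain a where a: "a \<in> A" by fastforce
  let ?I = "\<lambda>S. integral {0..2*pi} (\<lambda>t. \<Prod>h\<in>S. cos (t - \<phi> h))"
  let ?C = "(2 * \<kappa>) ^ m * fact m / (2 * pi)"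
  have "(\<Sum>M\<in>perfect_matchings (A - {a, b}). \<Prod>e\<in>M. w e) = ?C * ?I (A - {a, b})"
    if "b \<in> A - {a}" for b
    using Suc.prems that a by (intro Suc.IH) (auto simp: card_Diff_subset)
  then have "(\<Sum>M\<in>perfect_matchings A. \<Prod>e\<in>M. w e) =
      (\<Sum>b\<in>A - {a}. (\<kappa> * ?C) * (cos (\<phi> a - \<phi> b) * ?I (A - {a, b})))"
    unfolding sum_perfect_matchings_rec[OF Suc.prems(1) a]
    using Suc.prems(3) a by (intro sum.cong) auto
  also have "\<dots> = (\<kappa> * ?C) * (real (card A) * ?I A)"
    by (simp only: sum_distrib_left[symmetric] circle_integral_recursion[OF Suc.prems(1) a])
  also have "\<dots> = (2 * \<kappa>) ^ Suc m * fact (Suc m) / (2 * pi) * ?I A"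
    by (simp add: Suc.prems(2) field_simps)
  finally show ?case .
qed

section \<open>The annealed weight as a circle integral\<close>

lemma perfect_matchings_nonempty:
  assumes "finite A" "card A = 2 * m"
  shows "perfect_matchings A \<noteq> {}"
  using assms
proof (induction m arbitrary: A)
  case 0
  then show ?case by (simp add: perfect_matchings_empty)
next
  case (Suc m)
  then have "\<not> card A \<le> Suc 0" by simp
  then obtain a b where ab: "a \<in> A" "b \<in> A" "a \<noteq> b"
    using card_le_Suc0_iff_eq[OF Suc.prems(1)] by blast
  then have "perfect_matchings (A - {a, b}) \<noteq> {}"
    using Suc.prems by (intro Suc.IH) (auto simp: card_Diff_subset)
  moreover have "b \<in> A - {a}"
    using ab by simp
  ultimately show ?case
    unfolding perfect_matchings_decompose[OF ab(1)] by blast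
qed

lemma finite_spin_configs [simp]: "finite (spin_configs n)"
  by (simp add: spin_configs_def finite_PiE)

lemma spin_values: "\<sigma> \<in> spin_configs n \<Longrightarrow> i \<in> {1..n} \<Longrightarrow> \<sigma> i = 1 \<or> \<sigma> i = -1"
  by (auto simp: spin_configs_def PiE_def Pi_def)

lemma finite_half_edges: "finite (half_edges d n)"
  by (simp add: half_edges_def)

lemma even_card_half_edges:
  assumes "n \<ge> 1"
  shows "even (card (half_edges d n))"
proof -
  have "{1..n} = insert n {1..<n}"
    using assms by auto
  then have "card (half_edges d n) = vertex_degree d n n + (\<Sum>i=1..<n. vertex_degree d n i)"
    by (simp add: half_edges_def)
  also have "(\<Sum>i=1..<n. vertex_degree d n i) = (\<Sum>i=1..<n. d)"
    by (intro sum.cong) (auto simp: vertex_degree_def)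
  also have "vertex_degree d n n + \<dots> = (if odd (d * n) then d * n + 1 else d * n)"
    using assms by (cases n) (auto simp: vertex_degree_def)
  finally show ?thesis by auto
qed

text \<open>
  The Hamiltonian sums over ordered pairs \<open>i \<le> j\<close>; an edge with end vertices \<open>v\<close> and \<open>v'\<close> is counted
  exactly once, at \<open>(min v v', max v v')\<close>.
\<close>

lemma interaction_sum_eq_edge_sum:
  assumes "finite A" "\<And>h. h \<in> A \<Longrightarrow> fst h \<in> {1..n}" "M \<in> perfect_matchings A"
  shows "(\<Sum>i=1..n. \<Sum>j=i..n. real (edge_count M i j) * \<sigma> i * \<sigma> j)
       = (\<Sum>e\<in>M. \<Prod>h\<in>e. \<sigma> (fst h))"
proof -
  have part: "partition_on A M" and two: "\<And>e. e \<in> M \<Longrightarrow> card e = 2"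
    using assms(3) by (auto simp: perfect_matchings_def)
  have fin: "finite M"
    using finite_elements[OF assms(1) part] .
  have count: "real (edge_count M i j) = (\<Sum>e\<in>M. of_bool (fst ` e = {i, j}))" for i j
    using fin by (simp add: edge_count_def Int_def)
  have "(\<Sum>i=1..n. \<Sum>j=i..n. real (edge_count M i j) * \<sigma> i * \<sigma> j)
      = (\<Sum>(i, j)\<in>(SIGMA i:{1..n}. {i..n}). \<Sum>e\<in>M. of_bool (fst ` e = {i, j}) * \<sigma> i * \<sigma> j)"
    by (simp add: sum.Sigma count sum_distrib_right)
  also have "\<dots> = (\<Sum>e\<in>M. \<Sum>(i, j)\<in>(SIGMA i:{1..n}. {i..n}). of_bool (fst ` e = {i, j}) * \<sigma> i * \<sigma> j)"
    by (simp add: case_prod_unfold) (rule sum.swap)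
  also have "\<dots> = (\<Sum>e\<in>M. \<Prod>h\<in>e. \<sigma> (fst h))"
  proof (rule sum.cong[OF refl])
    fix e assume e: "e \<in> M"
    from two[OF e] obtain h k where hk: "e = {h, k}" "h \<noteq> k"
      by (auto simp: card_2_iff)
    define i0 j0 where "i0 = min (fst h) (fst k)" and "j0 = max (fst h) (fst k)"
    have "h \<in> A" "k \<in> A"
      using partition_onD1[OF part] e hk by auto
    then have mem: "(i0, j0) \<in> (SIGMA i:{1..n}. {i..n})"
      using assms(2)[of h] assms(2)[of k] by (auto simp: i0_def j0_def)
    have "(\<Sum>(i, j)\<in>(SIGMA i:{1..n}. {i..n}). of_bool (fst ` e = {i, j}) * \<sigma> i * \<sigma> j)
        = (\<Sum>p\<in>(SIGMA i:{1..n}. {i..n}). if p = (i0, j0) then \<sigma> i0 * \<sigma> j0 else 0)"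
      by (intro sum.cong) (auto simp: hk i0_def j0_def doubleton_eq_iff min_def max_def of_bool_def
          split: if_splits)
    also have "\<dots> = \<sigma> i0 * \<sigma> j0"
      using mem by (subst sum.delta) auto
    also have "\<dots> = (\<Prod>h\<in>e. \<sigma> (fst h))"
      using hk by (auto simp: i0_def j0_def min_def max_def)
    finally show "(\<Sum>(i, j)\<in>(SIGMA i:{1..n}. {i..n}). of_bool (fst ` e = {i, j}) * \<sigma> i * \<sigma> j)
        = (\<Prod>h\<in>e. \<sigma> (fst h))" .
  qed
  finally show ?thesis .
qed

text \<open>The weight of \<open>\<sigma>\<close> in the annealed measure at zero field, up to normalization.\<close>

definition spin_integral :: "nat \<Rightarrow> nat \<Rightarrow> real \<Rightarrow> (nat \<Rightarrow> real) \<Rightarrow> real" where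
  "spin_integral d n \<alpha> \<sigma> =
     integral {0..2*pi} (\<lambda>t. \<Prod>i=1..n. cos (t - \<sigma> i * \<alpha>) ^ vertex_degree d n i)"

text \<open>
  Assign to a half-edge at vertex \<open>i\<close> the angle \<open>\<sigma> i * \<alpha>\<close>. The choice of \<open>\<alpha>\<close> makes the edge weight
  \<open>exp (\<beta> * \<sigma> i * \<sigma> j)\<close> equal to \<open>exp \<beta>\<close> times the cosine of the difference of angles, so that the sum
  over matchings is a circle integral.
\<close>

lemma expectation_boltzmann_weight:
  assumes "n \<ge> 1" and \<alpha>: "cos (2 * \<alpha>) = exp (- 2 * \<beta>)"
  obtains K where "K > 0"
    and "\<And>\<sigma> B. \<sigma> \<in> spin_configs n \<Longrightarrow>
      measure_pmf.expectation (configuration_model d n) (\<lambda>M. exp (- hamiltonian n \<beta> B M \<sigma>))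
      = K * exp (B * total_spin n \<sigma>) * spin_integral d n \<alpha> \<sigma>"
proof -
  let ?H = "half_edges d n"
  let ?P = "perfect_matchings ?H"
  obtain m where m: "card ?H = 2 * m"
    using even_card_half_edges[OF assms(1)] by (auto elim: evenE)
  have fin: "finite ?P" and ne: "?P \<noteq> {}"
    using finite_perfect_matchings[OF finite_half_edges] perfect_matchings_nonempty[OF finite_half_edges m]
    by auto
  define K where "K = (2 * exp \<beta>) ^ m * fact m / (2 * pi) / real (card ?P)"
  have "K > 0"
    using fin ne by (simp add: K_def card_gt_0_iff)
  moreover have "measure_pmf.expectation (configuration_model d n) (\<lambda>M. exp (- hamiltonian n \<beta> B M \<sigma>))
      = K * exp (B * total_spin n \<sigma>) * spin_integral d n \<alpha> \<sigma>"
    if \<sigma>: "\<sigma> \<in> spin_configs n" for \<sigma> B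
  proof -
    define w where "w = (\<lambda>e :: (nat \<times> nat) set. exp (\<beta> * (\<Prod>h\<in>e. \<sigma> (fst h))))"
    have vertex: "fst h \<in> {1..n}" if "h \<in> ?H" for h
      using that by (auto simp: half_edges_def)
    have "exp (- hamiltonian n \<beta> B M \<sigma>) = exp (B * total_spin n \<sigma>) * (\<Prod>e\<in>M. w e)"
      if M: "M \<in> ?P" for M
    proof -
      have "finite M"
        using M finite_half_edges[of d n] finite_elements by (auto simp: perfect_matchings_def)
      then have "(\<Prod>e\<in>M. w e) = exp (\<beta> * (\<Sum>e\<in>M. \<Prod>h\<in>e. \<sigma> (fst h)))"
        by (simp add: w_def exp_sum sum_distrib_left)
      then show ?thesis
        using interaction_sum_eq_edge_sum[OF finite_half_edges vertex M, of \<sigma>]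
        by (simp add: hamiltonian_def total_spin_def flip: exp_add)
    qed
    then have "measure_pmf.expectation (configuration_model d n) (\<lambda>M. exp (- hamiltonian n \<beta> B M \<sigma>))
        = exp (B * total_spin n \<sigma>) * (\<Sum>M\<in>?P. \<Prod>e\<in>M. w e) / real (card ?P)"
      using fin ne by (simp add: configuration_model_def integral_pmf_of_set sum_distrib_left)
    also have "(\<Sum>M\<in>?P. \<Prod>e\<in>M. w e) = (2 * exp \<beta>) ^ m * fact m / (2 * pi) *
        integral {0..2*pi} (\<lambda>t. \<Prod>h\<in>?H. cos (t - \<sigma> (fst h) * \<alpha>))"
    proof (rule matching_sum_eq_circle_integral[OF finite_half_edges m])
      fix a b assume ab: "a \<in> ?H" "b \<in> ?H" "a \<noteq> b"
      have w: "w {a, b} = exp (\<beta> * (\<sigma> (fst a) * \<sigma> (fst b)))"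
        using ab by (simp add: w_def)
      have "exp \<beta> * cos (2 * \<alpha>) = exp (- \<beta>)"
        by (simp add: \<alpha> flip: exp_add)
      moreover have "cos (- \<alpha> - \<alpha>) = cos (2 * \<alpha>)"
        by (metis cos_minus minus_diff_eq diff_minus_eq_add mult_2)
      ultimately show "w {a, b} = exp \<beta> * cos (\<sigma> (fst a) * \<alpha> - \<sigma> (fst b) * \<alpha>)"
        using spin_values[OF \<sigma> vertex[OF ab(1)]] spin_values[OF \<sigma> vertex[OF ab(2)]]
        unfolding w by (elim disjE) simp_all
    qed
    also have "(\<lambda>t. \<Prod>h\<in>?H. cos (t - \<sigma> (fst h) * \<alpha>))
        = (\<lambda>t. \<Prod>i=1..n. cos (t - \<sigma> i * \<alpha>) ^ vertex_degree d n i)"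
    proof
      fix t
      have "(\<Prod>h\<in>?H. cos (t - \<sigma> (fst h) * \<alpha>))
          = (\<Prod>(i, k)\<in>?H. cos (t - \<sigma> i * \<alpha>))"
        by (simp add: case_prod_unfold)
      also have "\<dots> = (\<Prod>i=1..n. \<Prod>k<vertex_degree d n i. cos (t - \<sigma> i * \<alpha>))"
        unfolding half_edges_def by (subst prod.Sigma) auto
      finally show "(\<Prod>h\<in>?H. cos (t - \<sigma> (fst h) * \<alpha>))
          = (\<Prod>i=1..n. cos (t - \<sigma> i * \<alpha>) ^ vertex_degree d n i)"
        by simp
    qed
    finally show ?thesis
      by (simp add: K_def spin_integral_def field_simps)
  qed
  ultimately show ?thesis
    using that by blast
qed

lemma annealed_weight_eq:
  assumes "n \<ge> 1" "cos (2 * \<alpha>) = exp (- 2 * \<beta>)" "\<sigma> \<in> spin_configs n"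
  shows "annealed_weight d n \<beta> B \<sigma> =
    exp (B * total_spin n \<sigma>) * spin_integral d n \<alpha> \<sigma> /
    (\<Sum>\<tau>\<in>spin_configs n. exp (B * total_spin n \<tau>) * spin_integral d n \<alpha> \<tau>)"
proof -
  obtain K where K: "K > 0"
    and E: "\<And>\<sigma> B. \<sigma> \<in> spin_configs n \<Longrightarrow>
      measure_pmf.expectation (configuration_model d n) (\<lambda>M. exp (- hamiltonian n \<beta> B M \<sigma>))
      = K * exp (B * total_spin n \<sigma>) * spin_integral d n \<alpha> \<sigma>"
    using expectation_boltzmann_weight[OF assms(1,2)] by blast
  obtain m where m: "card (half_edges d n) = 2 * m"
    using even_card_half_edges[OF assms(1)] by (auto elim: evenE)
  have "finite (set_pmf (configuration_model d n))"
    using finite_perfect_matchings[OF finite_half_edges] perfect_matchings_nonempty[OF finite_half_edges m]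
    by (simp add: configuration_model_def set_pmf_of_set)
  then have "measure_pmf.expectation (configuration_model d n) (\<lambda>M. partition_function n \<beta> B M)
      = (\<Sum>\<tau>\<in>spin_configs n.
          measure_pmf.expectation (configuration_model d n) (\<lambda>M. exp (- hamiltonian n \<beta> B M \<tau>)))"
    unfolding partition_function_def
    by (intro Bochner_Integration.integral_sum integrable_measure_pmf_finite)
  also have "\<dots> = K * (\<Sum>\<tau>\<in>spin_configs n. exp (B * total_spin n \<tau>) * spin_integral d n \<alpha> \<tau>)"
    by (simp add: E sum_distrib_left mult.assoc)
  finally show ?thesis
    using K by (simp add: annealed_weight_def E[OF assms(3)] mult.assoc)
qed

text \<open>Not visible from the integrand, which may be negative: the integral is a multiple of the expectation of an exponential.\<close>

lemma spin_integral_nonneg: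
  assumes "n \<ge> 1" "cos (2 * \<alpha>) = exp (- 2 * \<beta>)" "\<sigma> \<in> spin_configs n"
  shows "spin_integral d n \<alpha> \<sigma> \<ge> 0"
proof -
  obtain K where K: "K > 0"
    and E: "\<And>\<sigma> B. \<sigma> \<in> spin_configs n \<Longrightarrow>
      measure_pmf.expectation (configuration_model d n) (\<lambda>M. exp (- hamiltonian n \<beta> B M \<sigma>))
      = K * exp (B * total_spin n \<sigma>) * spin_integral d n \<alpha> \<sigma>"
    using expectation_boltzmann_weight[OF assms(1,2)] by blast
  have "0 \<le> K * exp (0 * total_spin n \<sigma>) * spin_integral d n \<alpha> \<sigma>"
    unfolding E[OF assms(3), symmetric] by (rule Bochner_Integration.integral_nonneg) simp
  then show ?thesis
    using K by (simp add: zero_le_mult_iff)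
qed

section \<open>The one-site free energy\<close>

text \<open>
  The variable \<open>w\<close> is the relative difference \<open>\<bar>x - y\<bar> / (x + y)\<close> of two nonnegative numbers, so that
  \<open>x\<close> and \<open>y\<close> are proportional to \<open>1 + w\<close> and \<open>1 - w\<close> in some order.
\<close>

definition pow_sum :: "nat \<Rightarrow> real \<Rightarrow> real" where
  "pow_sum d w = (1 + w) ^ d + (1 - w) ^ d"

text \<open>The mean of a spin with weights \<open>(1 + w) ^ d\<close> for \<open>1\<close> and \<open>(1 - w) ^ d\<close> for \<open>-1\<close>.\<close>

definition bias :: "nat \<Rightarrow> real \<Rightarrow> real" where
  "bias d w = ((1 + w) ^ d - (1 - w) ^ d) / pow_sum d w"

definition rate :: "real \<Rightarrow> nat \<Rightarrow> real \<Rightarrow> real" where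
  "rate q d w = ln (pow_sum d w) - real d / 2 * ln (1 - q + (1 + q) * w\<^sup>2)"

text \<open>The derivative of \<open>rate\<close> up to a positive factor, see \<open>DERIV_rate\<close>.\<close>

definition rate_slope :: "real \<Rightarrow> nat \<Rightarrow> real \<Rightarrow> real" where
  "rate_slope q d w =
     (1 + w) ^ (d - 1) * (1 - q - (1 + q) * w) - (1 - w) ^ (d - 1) * (1 - q + (1 + q) * w)"

definition slope_coeff :: "real \<Rightarrow> nat \<Rightarrow> nat \<Rightarrow> real" where
  "slope_coeff q d i =
     (if odd i then 2 * ((1 - q) * real ((d - 1) choose i) - (1 + q) * real ((d - 1) choose (i - 1)))
      else 0)"

lemma pow_sum_ge_2: "0 \<le> w \<Longrightarrow> w \<le> 1 \<Longrightarrow> pow_sum d w \<ge> 2"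
  using Bernoulli_inequality[of w d] Bernoulli_inequality[of "- w" d]
  by (simp add: pow_sum_def)

lemma pow_sum_le: "0 \<le> w \<Longrightarrow> w \<le> 1 \<Longrightarrow> pow_sum d w \<le> 2 ^ (d + 1)"
  using power_mono[of "1 + w" 2 d] power_mono[of "1 - w" 2 d]
  by (simp add: pow_sum_def)

lemma DERIV_one_plus_power: "((\<lambda>x. (1 + x) ^ d) has_real_derivative real d * (1 + w) ^ (d - 1)) (at w)"
  by (auto intro!: derivative_eq_intros)

lemma DERIV_one_minus_power:
  "((\<lambda>x. (1 - x) ^ d) has_real_derivative - (real d * (1 - w) ^ (d - 1))) (at w)"
  by (auto intro!: derivative_eq_intros)

lemma DERIV_pow_sum:
  "(pow_sum d has_real_derivative real d * (1 + w) ^ (d - 1) - real d * (1 - w) ^ (d - 1)) (at w)"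
  unfolding pow_sum_def[abs_def]
  using DERIV_add[OF DERIV_one_plus_power DERIV_one_minus_power] by simp

lemma DERIV_rate:
  assumes "0 < q" "q < 1" "d \<ge> 1" "0 \<le> w" "w \<le> 1"
  shows "(rate q d has_real_derivative
           real d * rate_slope q d w / (pow_sum d w * (1 - q + (1 + q) * w\<^sup>2))) (at w)"
proof -
  obtain k where k: "d = Suc k" using assms(3) by (cases d) auto
  have E: "pow_sum d w > 0" using pow_sum_ge_2[of w d] assms by linarith
  have D: "1 - q + (1 + q) * w\<^sup>2 > 0" using assms by (intro add_pos_nonneg) auto
  have alg: "(n * a - n * b) / E - n / 2 * (B * (2 * w) / D) = n * ((a - b) * D - B * w * E) / (E * D)"
    if "E \<noteq> 0" "D \<noteq> 0" for n a b B D E :: real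
    using that by (simp add: field_simps)
  have "(rate q d has_real_derivative
      (real d * (1 + w) ^ k - real d * (1 - w) ^ k) / pow_sum d w
        - real d / 2 * ((1 + q) * (2 * w) / (1 - q + (1 + q) * w\<^sup>2))) (at w)"
  proof -
    have "((\<lambda>x. 1 - q + (1 + q) * x\<^sup>2) has_real_derivative (1 + q) * (2 * w)) (at w)"
      by (auto intro!: derivative_eq_intros)
    from DERIV_diff[OF DERIV_chain2[OF DERIV_ln_divide[OF E] DERIV_pow_sum]
        DERIV_cmult[OF DERIV_chain2[OF DERIV_ln_divide[OF D] this], of "real d / 2"]]
    show ?thesis by (simp add: rate_def[abs_def] k)
  qed
  also have "(real d * (1 + w) ^ k - real d * (1 - w) ^ k) / pow_sum d w
        - real d / 2 * ((1 + q) * (2 * w) / (1 - q + (1 + q) * w\<^sup>2))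
      = real d * (((1 + w) ^ k - (1 - w) ^ k) * (1 - q + (1 + q) * w\<^sup>2) - (1 + q) * w * pow_sum d w)
        / (pow_sum d w * (1 - q + (1 + q) * w\<^sup>2))"
    using E D by (intro alg) auto
  also have "((1 + w) ^ k - (1 - w) ^ k) * (1 - q + (1 + q) * w\<^sup>2) - (1 + q) * w * pow_sum d w
      = rate_slope q d w"
    by (simp add: pow_sum_def rate_slope_def k power2_eq_square algebra_simps)
  finally show ?thesis .
qed

text \<open>
  Both terms of \<open>rate_slope\<close> are values of one polynomial at \<open>w\<close> and \<open>- w\<close>, so that only odd powers
  survive.
\<close>

lemma rate_slope_expansion:
  assumes "d \<ge> 1"
  shows "rate_slope q d w = (\<Sum>i\<le>d. slope_coeff q d i * w ^ i)"
proof -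
  obtain k where k: "d = Suc k" using assms by (cases d) auto
  define odd_part where "odd_part = (\<lambda>i. w ^ i - (- w) ^ i)"
  have odd_part: "odd_part i = (if odd i then 2 * w ^ i else 0)" for i
    by (simp add: odd_part_def)
  have plus: "(1 + w) ^ k = (\<Sum>i\<le>k. real (k choose i) * w ^ i)"
    using binomial_ring[of w 1 k] by (simp add: add.commute)
  have minus: "(1 - w) ^ k = (\<Sum>i\<le>k. real (k choose i) * (- w) ^ i)"
    using binomial_ring[of "- w" 1 k] by simp
  have "rate_slope q d w =
      (\<Sum>i\<le>k. (1 - q) * real (k choose i) * odd_part i)
      - (\<Sum>i\<le>k. (1 + q) * real (k choose i) * odd_part (Suc i))"
    unfolding rate_slope_def k diff_Suc_1 plus minus
    by (simp add: sum_distrib_left sum_distrib_right odd_part_def algebra_simps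
        flip: sum_subtractf sum.distrib)
  also have "(\<Sum>i\<le>k. (1 - q) * real (k choose i) * odd_part i)
      = (\<Sum>i\<le>Suc k. (1 - q) * real (k choose i) * odd_part i)"
    by simp
  also have "(\<Sum>i\<le>k. (1 + q) * real (k choose i) * odd_part (Suc i))
      = (\<Sum>i\<le>Suc k. (1 + q) * real (k choose (i - 1)) * odd_part i)"
    by (subst sum.atMost_Suc_shift) (simp add: odd_part)
  also have "(\<Sum>i\<le>Suc k. (1 - q) * real (k choose i) * odd_part i)
        - (\<Sum>i\<le>Suc k. (1 + q) * real (k choose (i - 1)) * odd_part i)
      = (\<Sum>i\<le>d. slope_coeff q d i * w ^ i)"
    unfolding sum_subtractf[symmetric] k
    by (intro sum.cong) (auto simp: slope_coeff_def odd_part algebra_simps)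
  finally show ?thesis .
qed

text \<open>The last factor decreases in \<open>i\<close>, which is why the coefficients change sign at most once.\<close>

lemma slope_coeff_factor:
  assumes "odd i" "i \<le> d"
  shows "real i * slope_coeff q d i = 2 * real ((d - 1) choose (i - 1)) * ((1 - q) * real d - 2 * real i)"
proof -
  obtain j where j: "i = Suc j" using assms(1) by (cases i) auto
  obtain k where k: "d = Suc k" "j \<le> k" using assms(2) j by (cases d) auto
  have "Suc j * (k choose Suc j) = (k - j) * (k choose j)"
    using times_binomial_minus1_eq[of "Suc j" k] binomial_absorb_comp[of k j] by simp
  then have "real (Suc j) * real (k choose Suc j) = real (k - j) * real (k choose j)"
    by (simp only: flip: of_nat_mult)
  then have "real i * real (k choose i) = (real d - real i) * real (k choose j)"
    unfolding j k(1) of_nat_diff[OF k(2)] by simp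
  moreover have "real i * slope_coeff q d i
      = 2 * ((1 - q) * (real i * real (k choose i)) - (1 + q) * real i * real (k choose j))"
    using assms(1) by (simp add: slope_coeff_def j k right_diff_distrib mult.left_commute mult.assoc)
  ultimately have "real i * slope_coeff q d i
      = 2 * ((1 - q) * ((real d - real i) * real (k choose j)) - (1 + q) * real i * real (k choose j))"
    by simp
  also have "\<dots> = 2 * real (k choose j) * ((1 - q) * real d - 2 * real i)"
    by (simp add: algebra_simps)
  finally show ?thesis by (simp add: j k)
qed

lemma slope_coeff_nonneg:
  assumes "2 * real i \<le> (1 - q) * real d" "i \<le> d"
  shows "slope_coeff q d i \<ge> 0"
proof (cases "odd i")
  case True
  have "real i * slope_coeff q d i \<ge> 0"
    unfolding slope_coeff_factor[OF True assms(2)] using assms(1) by simp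
  then show ?thesis using odd_pos[OF True] by (simp add: zero_le_mult_iff)
qed (simp add: slope_coeff_def)

lemma slope_coeff_nonpos:
  assumes "2 * real i \<ge> (1 - q) * real d" "i \<le> d"
  shows "slope_coeff q d i \<le> 0"
proof (cases "odd i")
  case True
  have "real i * slope_coeff q d i \<le> 0"
    unfolding slope_coeff_factor[OF True assms(2)] using assms(1) by (simp add: mult_nonneg_nonpos)
  then show ?thesis using odd_pos[OF True] by (simp add: mult_le_0_iff)
qed (simp add: slope_coeff_def)

lemma slope_coeff_1: "d \<ge> 1 \<Longrightarrow> slope_coeff q d 1 = 2 * ((1 - q) * (real d - 1) - (1 + q))"
  by (simp add: slope_coeff_def of_nat_diff)

lemma diff_mult_diff_power_nonneg:
  fixes u w :: real
  assumes "0 \<le> u" "0 \<le> w"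
  shows "(u - w) * (u ^ m - w ^ m) \<ge> 0"
  using assms power_mono[of u w m] power_mono[of w u m]
  by (cases "u \<le> w") (auto intro: mult_nonpos_nonpos)

text \<open>
  A quantitative form of Descartes' rule for one sign change. As \<open>u\<close> is a root,
  \<open>u ^ J\<close> times the polynomial at \<open>w\<close> equals the sum of \<open>c i * (w ^ i * u ^ J - u ^ i * w ^ J)\<close>. Each of
  these terms has the sign of \<open>u - w\<close>: the bracket changes its sign at \<open>i = J\<close>, just as \<open>c i\<close> does.
  The term \<open>i = 1\<close> alone gives the bound; \<open>J \<ge> 2\<close> ensures that it does not vanish identically.
\<close>

lemma one_sign_change_bound:
  fixes c :: "nat \<Rightarrow> real"
  assumes root: "(\<Sum>i\<le>n. c i * u ^ i) = 0" and "n \<ge> 1" "J \<ge> 2" "c 0 = 0" "0 < u" "0 \<le> w"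
    and pos: "\<And>i. i \<le> J \<Longrightarrow> i \<le> n \<Longrightarrow> c i \<ge> 0" and neg: "\<And>i. i > J \<Longrightarrow> i \<le> n \<Longrightarrow> c i \<le> 0"
  shows "(u - w) * (\<Sum>i\<le>n. c i * w ^ i) * u \<ge> c 1 * w * (w - u)\<^sup>2"
proof -
  define T where "T = (\<lambda>i. c i * ((u - w) * (w ^ i * u ^ J - u ^ i * w ^ J)))"
  have T_nonneg: "T i \<ge> 0" if "i \<le> n" for i
  proof (cases "i \<le> J")
    case True
    then have "u ^ J = u ^ i * u ^ (J - i)" "w ^ J = w ^ i * w ^ (J - i)"
      by (simp_all flip: power_add)
    then have eq: "(u - w) * (w ^ i * u ^ J - u ^ i * w ^ J)
        = (u * w) ^ i * ((u - w) * (u ^ (J - i) - w ^ (J - i)))"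
      by (simp add: power_mult_distrib algebra_simps)
    have "(u - w) * (w ^ i * u ^ J - u ^ i * w ^ J) \<ge> 0"
      unfolding eq using diff_mult_diff_power_nonneg[of u w "J - i"] assms by simp
    then show ?thesis using pos[OF True that] by (simp add: T_def)
  next
    case False
    then have "u ^ i = u ^ J * u ^ (i - J)" "w ^ i = w ^ J * w ^ (i - J)"
      by (simp_all flip: power_add)
    then have "(u - w) * (w ^ i * u ^ J - u ^ i * w ^ J)
        = - ((u * w) ^ J * ((u - w) * (u ^ (i - J) - w ^ (i - J))))"
      by (simp add: power_mult_distrib algebra_simps)
    moreover have "(u * w) ^ J * ((u - w) * (u ^ (i - J) - w ^ (i - J))) \<ge> 0"
      using diff_mult_diff_power_nonneg[of u w "i - J"] assms by simp
    ultimately have "(u - w) * (w ^ i * u ^ J - u ^ i * w ^ J) \<le> 0"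
      by linarith
    then show ?thesis using neg[of i] False that by (simp add: T_def mult_nonpos_nonpos)
  qed
  obtain m where m: "J = m + 2" using assms(3) by (metis add.commute le_iff_add)
  have "c 1 * (w * u * (w - u)\<^sup>2 * u ^ m) \<le> T 1"
  proof -
    have "(u - w) * (w * u ^ J - u * w ^ J)
        = w * u * (w - u)\<^sup>2 * u ^ m + w * w * u * ((u - w) * (u ^ m - w ^ m))"
      by (simp add: m power2_eq_square algebra_simps)
    moreover have "w * w * u * ((u - w) * (u ^ m - w ^ m)) \<ge> 0"
      using diff_mult_diff_power_nonneg[of u w m] assms by simp
    ultimately show ?thesis
      using pos[of 1] assms unfolding T_def by (intro mult_left_mono) auto
  qed
  also have "T 1 \<le> (\<Sum>i\<le>n. T i)"
    using T_nonneg assms(2) by (intro member_le_sum) auto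
  also have "\<dots> = (u - w) * ((\<Sum>i\<le>n. c i * w ^ i) * u ^ J - (\<Sum>i\<le>n. c i * u ^ i) * w ^ J)"
    by (simp add: T_def sum_distrib_left sum_distrib_right algebra_simps flip: sum_subtractf)
  also have "\<dots> = u * u ^ m * ((u - w) * (\<Sum>i\<le>n. c i * w ^ i) * u)"
    unfolding root by (simp add: m power2_eq_square algebra_simps)
  finally have "u * u ^ m * (c 1 * w * (w - u)\<^sup>2) \<le> u * u ^ m * ((u - w) * (\<Sum>i\<le>n. c i * w ^ i) * u)"
    by (simp add: algebra_simps)
  then show ?thesis
    using assms by (subst (asm) mult_le_cancel_left_pos) auto
qed

text \<open>The slope is positive just to the right of \<open>0\<close> and negative at \<open>1\<close>.\<close>

lemma rate_slope_root:
  assumes "0 < q" "q < 1" "d \<ge> 2" "(real d - 1) * (1 - q) > 1 + q"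
  obtains u where "0 < u" "u < 1" "rate_slope q d u = 0"
proof -
  have deriv0: "(rate_slope q d has_real_derivative 2 * ((real d - 1) * (1 - q) - (1 + q))) (at 0)"
  proof -
    have "((\<lambda>w. 1 - q - (1 + q) * w) has_real_derivative - (1 + q)) (at 0)"
      "((\<lambda>w. 1 - q + (1 + q) * w) has_real_derivative 1 + q) (at 0)"
      by (auto intro!: derivative_eq_intros)
    note D = DERIV_diff[OF DERIV_mult[OF DERIV_one_plus_power this(1)] DERIV_mult[OF DERIV_one_minus_power this(2)],
        of "d - 1" "d - 1"]
    show ?thesis unfolding rate_slope_def[abs_def]
    proof (rule DERIV_cong[OF D])
      define k where "k = real d - 1"
      have "real (d - 1) = k" using assms(3) by (simp add: k_def of_nat_diff)
      then show "real (d - 1) * (1 + 0) ^ (d - 1 - 1) * (1 - q - (1 + q) * 0) + - (1 + q) * (1 + 0) ^ (d - 1)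
          - (- (real (d - 1) * (1 - 0) ^ (d - 1 - 1)) * (1 - q + (1 + q) * 0) + (1 + q) * (1 - 0) ^ (d - 1))
          = 2 * ((real d - 1) * (1 - q) - (1 + q))"
        unfolding k_def[symmetric] by (simp add: algebra_simps)
    qed
  qed
  have pos: "2 * ((real d - 1) * (1 - q) - (1 + q)) > 0"
    using assms(4) by simp
  have "\<exists>e>0. \<forall>h>0. h < e \<longrightarrow> rate_slope q d 0 < rate_slope q d (0 + h)"
    using DERIV_pos_inc_right[OF deriv0 pos] .
  then obtain e where e: "e > 0" "\<And>h. 0 < h \<Longrightarrow> h < e \<Longrightarrow> rate_slope q d 0 < rate_slope q d (0 + h)"
    by blast
  define h where "h = min (e / 2) (1 / 2)"
  have h: "0 < h" "h < 1" "h < e" using e(1) by (auto simp: h_def)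
  have pos: "rate_slope q d h > 0"
  proof -
    have "rate_slope q d 0 = 0" by (simp add: rate_slope_def)
    then show ?thesis using e(2)[OF h(1,3)] by simp
  qed
  have neg: "rate_slope q d 1 < 0"
  proof -
    have "(0 :: real) ^ (d - 1) = 0" using assms(3) by simp
    then have "rate_slope q d 1 = - (2 * q * 2 ^ (d - 1))"
      unfolding rate_slope_def diff_self by (simp only:) (simp add: algebra_simps)
    then show ?thesis using assms(1) by simp
  qed
  have "\<exists>u. h \<le> u \<and> u \<le> 1 \<and> rate_slope q d u = 0"
  proof (rule IVT2)
    show "rate_slope q d 1 \<le> 0" "0 \<le> rate_slope q d h" "h \<le> 1"
      using pos neg h by linarith+
    show "\<forall>x. h \<le> x \<and> x \<le> 1 \<longrightarrow> isCont (rate_slope q d) x"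
      unfolding rate_slope_def[abs_def] by (intro allI impI continuous_intros)
  qed
  then obtain u where u: "h \<le> u" "u \<le> 1" "rate_slope q d u = 0" by blast
  have "u \<noteq> 1"
  proof
    assume "u = 1"
    with u(3) neg show False by simp
  qed
  show ?thesis
  proof (rule that)
    show "0 < u" "u < 1" using u h \<open>u \<noteq> 1\<close> by linarith+
  qed (rule u(3))
qed

text \<open>
  The sign change of the slope at \<open>u\<close> is at least linear, up to a factor \<open>w\<close> by which the slope vanishes
  at \<open>0\<close>. So \<open>rate\<close> may be corrected by a cubic with derivative proportional to \<open>w * (w - u)\<close> and still
  has its maximum at \<open>u\<close>; the cubic exceeds its value at \<open>u\<close> by at least a multiple of \<open>(w - u)\<^sup>2\<close>.
\<close>

lemma rate_max_supercritical:
  assumes "0 < q" "q < 1" "d \<ge> 2" "(real d - 1) * (1 - q) > 1 + q"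
  obtains u c where "0 < u" "u < 1" "c > 0"
    "\<And>w. 0 \<le> w \<Longrightarrow> w \<le> 1 \<Longrightarrow> rate q d w \<le> rate q d u - c * (w - u)\<^sup>2"
proof -
  obtain u where u: "0 < u" "u < 1" and root: "rate_slope q d u = 0"
    using rate_slope_root[OF assms] .
  define c1 where "c1 = slope_coeff q d 1"
  have c1: "c1 > 0" using assms unfolding c1_def by (subst slope_coeff_1) (auto simp: algebra_simps)
  \<comment> \<open>Coefficients up to \<open>(1 - q) * d / 2\<close> are nonnegative, later ones nonpositive; that of \<open>w ^ 2\<close> is \<open>0\<close>, so the threshold can be raised to \<open>2\<close>.\<close>
  define J where "J = max 2 (nat \<lfloor>(1 - q) * real d / 2\<rfloor>)"
  have slope: "(u - w) * rate_slope q d w * u \<ge> c1 * w * (w - u)\<^sup>2" if "0 \<le> w" for w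
  proof -
    have d: "d \<ge> 1" using assms by simp
    have "(\<Sum>i\<le>d. slope_coeff q d i * u ^ i) = 0"
      using rate_slope_expansion[OF d] root by metis
    moreover have "slope_coeff q d i \<ge> 0" if "i \<le> J" "i \<le> d" for i
    proof -
      have "i = 0 \<or> i = 1 \<or> i = 2 \<or> i \<le> nat \<lfloor>(1 - q) * real d / 2\<rfloor>"
        using that by (auto simp: J_def)
      moreover have "2 * real i \<le> (1 - q) * real d" if "i \<le> nat \<lfloor>(1 - q) * real d / 2\<rfloor>"
        using that assms by (simp add: le_nat_floor le_nat_iff le_floor_iff)
      ultimately show ?thesis
        using c1 slope_coeff_nonneg[of i q d] that by (auto simp: c1_def slope_coeff_def[of q d 0] slope_coeff_def[of q d 2])
    qed
    moreover have "slope_coeff q d i \<le> 0" if "i > J" "i \<le> d" for i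
    proof -
      have "0 \<le> \<lfloor>(1 - q) * real d / 2\<rfloor>" using assms by simp
      then have "int i > \<lfloor>(1 - q) * real d / 2\<rfloor>" using that by (simp add: J_def nat_less_iff)
      then have "(1 - q) * real d / 2 < real i" by linarith
      then show ?thesis using slope_coeff_nonpos[of q d i] that by simp
    qed
    ultimately show ?thesis
      unfolding rate_slope_expansion[OF d] c1_def using u that d
      by (intro one_sign_change_bound[where J = J]) (auto simp: J_def slope_coeff_def)
  qed
  \<comment> \<open>The denominator in \<open>DERIV_rate\<close> is at most \<open>2 ^ (d + 2)\<close>.\<close>
  define c0 where "c0 = real d * c1 / (u * 2 ^ (d + 3))"
  have c0: "c0 > 0" using c1 u assms by (simp add: c0_def)
  define h where "h = (\<lambda>w. rate q d w + c0 * (2 / 3 * w ^ 3 - u * w\<^sup>2))"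
  define h' where "h' = (\<lambda>w. real d * rate_slope q d w / (pow_sum d w * (1 - q + (1 + q) * w\<^sup>2))
      + 2 * c0 * w * (w - u))"
  have dh: "(h has_real_derivative h' w) (at w)" if "0 \<le> w" "w \<le> 1" for w
    unfolding h_def h'_def using assms that
    by (auto intro!: derivative_eq_intros DERIV_rate simp: power2_eq_square algebra_simps)
  have sign: "(u - w) * h' w \<ge> 0" if w: "0 \<le> w" "w \<le> 1" for w
  proof -
    define V where "V = pow_sum d w * (1 - q + (1 + q) * w\<^sup>2)"
    have w2: "w\<^sup>2 \<le> 1" using w by (simp add: power_le_one)
    have D: "0 < 1 - q + (1 + q) * w\<^sup>2" using assms by (intro add_pos_nonneg) auto
    have "(1 + q) * w\<^sup>2 \<le> (1 + q) * 1"
      using w2 assms by (intro mult_left_mono) auto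
    then have "1 - q + (1 + q) * w\<^sup>2 \<le> 2" by (simp add: algebra_simps)
    then have V: "0 < V" "V \<le> 2 ^ (d + 2)"
      using pow_sum_ge_2[OF w, of d] mult_mono[OF pow_sum_le[OF w, of d], of "1 - q + (1 + q) * w\<^sup>2" 2] D
      by (auto simp: V_def mult.commute)
    have "2 * c0 * w * (w - u)\<^sup>2 = real d * (c1 * w * (w - u)\<^sup>2) / (u * 2 ^ (d + 2))"
      using u by (simp add: c0_def field_simps power_add)
    also have "\<dots> \<le> real d * (c1 * w * (w - u)\<^sup>2) / (u * V)"
      using V u c1 w by (intro divide_left_mono mult_left_mono mult_pos_pos) auto
    also have "\<dots> \<le> real d * ((u - w) * rate_slope q d w * u) / (u * V)"
      using V u slope[OF w(1)] by (intro divide_right_mono mult_left_mono) auto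
    also have "\<dots> = (u - w) * (real d * rate_slope q d w / V)"
      using u V by (simp add: field_simps)
    finally show ?thesis
      by (simp add: h'_def V_def power2_eq_square algebra_simps)
  qed
  have h_le: "h w \<le> h u" if w: "0 \<le> w" "w \<le> 1" for w
  proof (cases "w \<le> u")
    case True
    show ?thesis
    proof (rule DERIV_nonneg_imp_nondecreasing[OF True])
      fix x assume x: "w \<le> x" "x \<le> u"
      have "h' x \<ge> 0 \<or> x = u" using sign[of x] x w u by (auto simp: zero_le_mult_iff)
      moreover have "h' u = 0" using root by (simp add: h'_def)
      ultimately show "\<exists>y. (h has_real_derivative y) (at x) \<and> 0 \<le> y"
        using dh[of x] x w u by (intro exI[of _ "h' x"]) auto
    qed
  next
    case False
    then have "u \<le> w" by simp
    then show ?thesis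
    proof (rule DERIV_nonpos_imp_nonincreasing)
      fix x assume x: "u \<le> x" "x \<le> w"
      have "h' x \<le> 0 \<or> x = u" using sign[of x] x w u by (auto simp: zero_le_mult_iff)
      moreover have "h' u = 0" using root by (simp add: h'_def)
      ultimately show "\<exists>y. (h has_real_derivative y) (at x) \<and> y \<le> 0"
        using dh[of x] x w u by (intro exI[of _ "h' x"]) auto
    qed
  qed
  show ?thesis
  proof (rule that[OF u, of "c0 * u / 3"])
    show "c0 * u / 3 > 0" using c0 u by simp
    fix w :: real assume w: "0 \<le> w" "w \<le> 1"
    have "(2 / 3 * w ^ 3 - u * w\<^sup>2) - (2 / 3 * u ^ 3 - u * u\<^sup>2) = (w - u)\<^sup>2 * (2 * w + u) / 3"
      by (simp add: power2_eq_square power3_eq_cube algebra_simps)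
    moreover have "(w - u)\<^sup>2 * (2 * w + u) / 3 \<ge> (w - u)\<^sup>2 * u / 3"
      using w by (intro divide_right_mono mult_left_mono) auto
    ultimately have "c0 * ((w - u)\<^sup>2 * u / 3)
        \<le> c0 * ((2 / 3 * w ^ 3 - u * w\<^sup>2) - (2 / 3 * u ^ 3 - u * u\<^sup>2))"
      using c0 by (intro mult_left_mono) auto
    with h_le[OF w] show "rate q d w \<le> rate q d u - c0 * u / 3 * (w - u)\<^sup>2"
      by (simp add: h_def algebra_simps)
  qed
qed

text \<open>
  Here no coefficient of the slope is positive and that of \<open>w\<close> is negative, so the slope is at most
  a negative multiple of \<open>w\<close>.
\<close>

lemma rate_max_subcritical:
  assumes "0 < q" "q < 1" "d \<ge> 2" "(real d - 1) * (1 - q) < 1 + q"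
  obtains c where "c > 0" "\<And>w. 0 \<le> w \<Longrightarrow> w \<le> 1 \<Longrightarrow> rate q d w \<le> rate q d 0 - c * w\<^sup>2"
proof -
  have d: "d \<ge> 1" using assms by simp
  define c1 where "c1 = - slope_coeff q d 1"
  have c1: "c1 > 0" using assms unfolding c1_def by (subst slope_coeff_1) (auto simp: algebra_simps)
  have coeff: "slope_coeff q d i \<le> 0" if "i \<le> d" for i
  proof (cases "i = 0")
    case True then show ?thesis by (simp add: slope_coeff_def)
  next
    case False
    have "(1 - q) * real d < 2" using assms(4) by (simp add: algebra_simps)
    with False have "(1 - q) * real d \<le> 2 * real i" by simp
    then show ?thesis using slope_coeff_nonpos that by blast
  qed
  have slope: "rate_slope q d w \<le> - c1 * w" if "0 \<le> w" for w
  proof -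
    have "(\<Sum>i\<le>d. - (slope_coeff q d i * w ^ i)) \<ge> - (slope_coeff q d 1 * w ^ 1)"
      using d coeff that by (intro member_le_sum) (auto simp: mult_nonpos_nonneg)
    then show ?thesis
      unfolding rate_slope_expansion[OF d] by (simp add: sum_negf c1_def)
  qed
  define c where "c = real d * c1 / 2 ^ (d + 3)"
  have c: "c > 0" using c1 d by (simp add: c_def)
  have le: "rate q d w + c * w\<^sup>2 \<le> rate q d 0 + c * 0\<^sup>2" if w: "0 \<le> w" "w \<le> 1" for w
  proof (rule DERIV_nonpos_imp_nonincreasing[OF w(1)])
    fix x assume x: "0 \<le> x" "x \<le> w"
    define V where "V = pow_sum d x * (1 - q + (1 + q) * x\<^sup>2)"
    have x1: "x \<le> 1" using x w by simp
    have x2: "x\<^sup>2 \<le> 1" using x x1 by (simp add: power_le_one)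
    have D: "0 < 1 - q + (1 + q) * x\<^sup>2" using assms by (intro add_pos_nonneg) auto
    have "(1 + q) * x\<^sup>2 \<le> (1 + q) * 1"
      using x2 assms by (intro mult_left_mono) auto
    then have "1 - q + (1 + q) * x\<^sup>2 \<le> 2" by (simp add: algebra_simps)
    then have V: "0 < V" "V \<le> 2 ^ (d + 2)"
      using pow_sum_ge_2[OF x(1) x1, of d]
        mult_mono[OF pow_sum_le[OF x(1) x1, of d], of "1 - q + (1 + q) * x\<^sup>2" 2] D
      by (auto simp: V_def mult.commute)
    have "2 * c * x = real d * (c1 * x) / 2 ^ (d + 2)"
      by (simp add: c_def field_simps power_add)
    also have "\<dots> \<le> real d * (c1 * x) / V"
      using V c1 x by (intro divide_left_mono mult_pos_pos) auto
    also have "\<dots> \<le> real d * (- rate_slope q d x) / V"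
      using V slope[OF x(1)] by (intro divide_right_mono mult_left_mono) auto
    finally have "real d * rate_slope q d x / V + 2 * c * x \<le> 0" by simp
    moreover have "((\<lambda>x. rate q d x + c * x\<^sup>2) has_real_derivative
        real d * rate_slope q d x / V + 2 * c * x) (at x)"
      using assms x x1 d unfolding V_def by (auto intro!: derivative_eq_intros DERIV_rate)
    ultimately show "\<exists>y. ((\<lambda>x. rate q d x + c * x\<^sup>2) has_real_derivative y) (at x) \<and> y \<le> 0"
      by blast
  qed
  show ?thesis
  proof (rule that[OF c])
    fix w :: real assume "0 \<le> w" "w \<le> 1"
    from le[OF this] show "rate q d w \<le> rate q d 0 - c * w\<^sup>2" by simp
  qed
qed

text \<open>
  The derivative is \<open>4 * d * (1 - w\<^sup>2) ^ (d - 1)\<close> divided by the square of a number that is at least \<open>2\<close>.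
\<close>

lemma bias_Lipschitz:
  assumes "d \<ge> 1" "0 \<le> w" "w \<le> 1" "0 \<le> u" "u \<le> 1"
  shows "\<bar>bias d w - bias d u\<bar> \<le> real d * \<bar>w - u\<bar>"
proof -
  obtain k where k: "d = Suc k" using assms(1) by (cases d) auto
  have deriv: "(bias d has_real_derivative 4 * real d * ((1 + x) * (1 - x)) ^ k / (pow_sum d x)\<^sup>2) (at x)"
    if x: "0 \<le> x" "x \<le> 1" for x
  proof -
    have E: "pow_sum d x \<noteq> 0" using pow_sum_ge_2[OF x, of d] by auto
    have "(bias d has_real_derivative
        ((real d * (1 + x) ^ k + real d * (1 - x) ^ k) * pow_sum d x
         - ((1 + x) ^ d - (1 - x) ^ d) * (real d * (1 + x) ^ k - real d * (1 - x) ^ k))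
        / (pow_sum d x * pow_sum d x)) (at x)"
      unfolding bias_def[abs_def]
      using E DERIV_pow_sum[of d x] DERIV_diff[OF DERIV_one_plus_power[of d x] DERIV_one_minus_power[of d x]]
      by (intro DERIV_divide) (auto simp: k)
    also have "(real d * (1 + x) ^ k + real d * (1 - x) ^ k) * pow_sum d x
         - ((1 + x) ^ d - (1 - x) ^ d) * (real d * (1 + x) ^ k - real d * (1 - x) ^ k)
        = 4 * real d * ((1 + x) ^ k * (1 - x) ^ k)"
      by (simp add: pow_sum_def k algebra_simps)
    finally show ?thesis by (simp add: power_mult_distrib power2_eq_square)
  qed
  have "norm (bias d w - bias d u) \<le> real d * norm (w - u)"
  proof (rule field_differentiable_bound[of "{0..1}" "bias d"
        "\<lambda>x. 4 * real d * ((1 + x) * (1 - x)) ^ k / (pow_sum d x)\<^sup>2"])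
    fix x :: real assume x: "x \<in> {0..1}"
    show "(bias d has_field_derivative 4 * real d * ((1 + x) * (1 - x)) ^ k / (pow_sum d x)\<^sup>2)
        (at x within {0..1})"
      using deriv x by (auto intro: has_field_derivative_at_within)
    have x2: "x * x \<le> 1" using x mult_le_one[of x x] by auto
    have "(1 + x) * (1 - x) = 1 - x * x" by (simp add: algebra_simps)
    then have p: "0 \<le> ((1 + x) * (1 - x)) ^ k" "((1 + x) * (1 - x)) ^ k \<le> 1"
      using x2 by (auto intro: power_le_one)
    have "2\<^sup>2 \<le> (pow_sum d x)\<^sup>2"
      using x pow_sum_ge_2[of x d] by (intro power_mono) auto
    then have "4 * real d * ((1 + x) * (1 - x)) ^ k / (pow_sum d x)\<^sup>2 \<le> 4 * real d * 1 / 2\<^sup>2"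
      using p by (intro frac_le mult_left_mono) auto
    then show "norm (4 * real d * ((1 + x) * (1 - x)) ^ k / (pow_sum d x)\<^sup>2) \<le> real d"
      using p by simp
  qed (use assms in auto)
  then show ?thesis by simp
qed

lemma bias_pos:
  assumes "d \<ge> 1" "0 < u" "u \<le> 1"
  shows "bias d u > 0"
proof -
  have "(1 - u) ^ d < (1 + u) ^ d"
    using assms by (intro power_strict_mono) auto
  then show ?thesis
    using pow_sum_ge_2[of u d] assms by (simp add: bias_def)
qed

section \<open>From angles to magnetizations\<close>

text \<open>
  With \<open>\<rho> = (x + y) / 2\<close>, the numbers \<open>x\<close> and \<open>y\<close> are \<open>\<rho> * (1 + w)\<close> and \<open>\<rho> * (1 - w)\<close> in some order, and
  the quadratic form is \<open>2 * \<rho>\<^sup>2 * (1 - q + (1 + q) * w\<^sup>2)\<close>. A bound on the form thus bounds \<open>\<rho>\<close>, and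
  \<open>x ^ d + y ^ d\<close> is homogeneous in \<open>\<rho>\<close>.
\<close>

lemma ln_power_sum_le:
  fixes x y q :: real
  assumes q: "0 < q" "q < 1" and xy: "0 \<le> x" "0 \<le> y" "x + y > 0"
  defines "w \<equiv> \<bar>x - y\<bar> / (x + y)"
  shows "0 \<le> w" "w \<le> 1" "x ^ d + y ^ d > 0" "\<bar>(x ^ d - y ^ d) / (x ^ d + y ^ d)\<bar> = bias d w"
    and "x\<^sup>2 + y\<^sup>2 - 2 * q * x * y \<le> 1 - q\<^sup>2 \<Longrightarrow>
      ln (x ^ d + y ^ d) \<le> rate q d w + real d / 2 * ln ((1 - q\<^sup>2) / 2)"
    and "x\<^sup>2 + y\<^sup>2 - 2 * q * x * y = 1 - q\<^sup>2 \<Longrightarrow>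
      ln (x ^ d + y ^ d) = rate q d w + real d / 2 * ln ((1 - q\<^sup>2) / 2)"
proof -
  define \<rho> where "\<rho> = (x + y) / 2"
  have \<rho>: "\<rho> > 0" using xy by (simp add: \<rho>_def)
  show w: "0 \<le> w" "w \<le> 1"
    using xy by (auto simp: w_def)
  have "(x + y) * w = \<bar>x - y\<bar>"
    using xy by (simp add: w_def)
  then have "\<rho> * w = \<bar>x - y\<bar> / 2"
    by (simp add: \<rho>_def)
  then have cases: "(x = \<rho> * (1 + w) \<and> y = \<rho> * (1 - w)) \<or> (x = \<rho> * (1 - w) \<and> y = \<rho> * (1 + w))"
    by (cases "x \<ge> y") (auto simp: \<rho>_def right_diff_distrib distrib_left field_simps)
  have S: "x ^ d + y ^ d = \<rho> ^ d * pow_sum d w"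
    using cases by (elim disjE conjE) (simp_all only: pow_sum_def power_mult_distrib, simp_all add: distrib_left)
  have E: "pow_sum d w > 0"
    using pow_sum_ge_2[OF w, of d] by linarith
  show S_pos: "x ^ d + y ^ d > 0"
    using \<rho> E by (simp add: S)
  have "(1 - w) ^ d \<le> (1 + w) ^ d"
    using w by (intro power_mono) auto
  then have "\<bar>x ^ d - y ^ d\<bar> = \<rho> ^ d * ((1 + w) ^ d - (1 - w) ^ d)"
    using cases \<rho> by (auto simp: power_mult_distrib abs_mult simp flip: right_diff_distrib)
  then show "\<bar>(x ^ d - y ^ d) / (x ^ d + y ^ d)\<bar> = bias d w"
    using S_pos \<rho> by (simp add: S bias_def abs_divide)
  define D where "D = 1 - q + (1 + q) * w\<^sup>2"
  have D: "D > 0" unfolding D_def using q by (intro add_pos_nonneg) auto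
  have Q: "x\<^sup>2 + y\<^sup>2 - 2 * q * x * y = 2 * \<rho>\<^sup>2 * D"
    using cases by (elim disjE conjE) (simp_all only: D_def, simp_all add: power2_eq_square algebra_simps)
  have "ln (x ^ d + y ^ d) = real d * ln \<rho> + ln (pow_sum d w)"
    using \<rho> E by (simp add: S ln_mult ln_realpow)
  also have "\<dots> = rate q d w + real d / 2 * ln (\<rho>\<^sup>2 * D)"
    using \<rho> D unfolding rate_def D_def[symmetric] by (simp add: ln_mult ln_realpow algebra_simps)
  finally have ln_eq: "ln (x ^ d + y ^ d) = rate q d w + real d / 2 * ln (\<rho>\<^sup>2 * D)" .
  show "ln (x ^ d + y ^ d) = rate q d w + real d / 2 * ln ((1 - q\<^sup>2) / 2)"
    if "x\<^sup>2 + y\<^sup>2 - 2 * q * x * y = 1 - q\<^sup>2"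
  proof -
    have "\<rho>\<^sup>2 * D = (1 - q\<^sup>2) / 2" using that Q by simp
    then show ?thesis by (simp only: ln_eq)
  qed
  show "ln (x ^ d + y ^ d) \<le> rate q d w + real d / 2 * ln ((1 - q\<^sup>2) / 2)"
    if "x\<^sup>2 + y\<^sup>2 - 2 * q * x * y \<le> 1 - q\<^sup>2"
  proof -
    have "\<rho>\<^sup>2 * D \<le> (1 - q\<^sup>2) / 2" using that Q by simp
    then have "ln (\<rho>\<^sup>2 * D) \<le> ln ((1 - q\<^sup>2) / 2)"
      using \<rho> D by (intro ln_mono) auto
    then show ?thesis
      unfolding ln_eq by (intro add_left_mono mult_left_mono) auto
  qed
qed

lemma cos_pair_ellipse:
  fixes t \<alpha> :: real
  shows "(cos (t - \<alpha>))\<^sup>2 + (cos (t + \<alpha>))\<^sup>2 - 2 * cos (2 * \<alpha>) * cos (t - \<alpha>) * cos (t + \<alpha>)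
    = 1 - (cos (2 * \<alpha>))\<^sup>2"
proof -
  let ?a = "t - \<alpha>" and ?b = "t + \<alpha>"
  have "2 * \<alpha> = ?b - ?a" by simp
  then have "cos (2 * \<alpha>) = cos ?b * cos ?a + sin ?b * sin ?a"
    by (metis cos_diff)
  then have "(cos (2 * \<alpha>) - cos ?a * cos ?b)\<^sup>2 = (sin ?a)\<^sup>2 * (sin ?b)\<^sup>2"
    by (simp add: power2_eq_square mult_ac)
  also have "\<dots> = (1 - (cos ?a)\<^sup>2) * (1 - (cos ?b)\<^sup>2)"
    by (simp only: sin_squared_eq)
  finally show ?thesis
    by (simp add: power2_eq_square algebra_simps)
qed

text \<open>
  At angle \<open>t\<close> a vertex of degree \<open>d\<close> has total weight \<open>spin_sum\<close> and mean spin \<open>spin_bias\<close>, if the weights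
  are replaced by their absolute values.
\<close>

definition spin_sum :: "nat \<Rightarrow> real \<Rightarrow> real \<Rightarrow> real" where
  "spin_sum d \<alpha> t = \<bar>cos (t - \<alpha>)\<bar> ^ d + \<bar>cos (t + \<alpha>)\<bar> ^ d"

definition spin_bias :: "nat \<Rightarrow> real \<Rightarrow> real \<Rightarrow> real" where
  "spin_bias d \<alpha> t = (\<bar>cos (t - \<alpha>)\<bar> ^ d - \<bar>cos (t + \<alpha>)\<bar> ^ d) / spin_sum d \<alpha> t"

text \<open>
  All that the concentration argument needs to know about the angles: the total weight of a spin is
  largest at an angle \<open>t0\<close> at which both weights are positive, and it falls off quadratically in the
  distance of the absolute bias from \<open>\<nu>\<close>. The subcritical and the supercritical regime both
  have this form, with \<open>\<nu> = 0\<close> and \<open>\<nu> > 0\<close>.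
\<close>

locale spin_landscape =
  fixes d :: nat and \<beta> \<alpha> \<nu> \<kappa> t0 :: real
  assumes angle: "cos (2 * \<alpha>) = exp (- 2 * \<beta>)"
    and beta_pos: "\<beta> > 0" and d_pos: "d \<ge> 1" and kappa_pos: "\<kappa> > 0" and nu_nonneg: "\<nu> \<ge> 0"
    and t0: "0 \<le> t0" "t0 \<le> pi / 2" "cos (t0 - \<alpha>) > 0" "cos (t0 + \<alpha>) > 0"
    and spin_sum_pos: "spin_sum d \<alpha> t > 0"
    and spin_sum_le: "spin_sum d \<alpha> t \<le>
      spin_sum d \<alpha> t0 * exp (- \<kappa> * (\<bar>spin_bias d \<alpha> t\<bar> - \<nu>)\<^sup>2)"

text \<open>
  Taking absolute values of the two cosines only decreases the quadratic form of the ellipse, so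
  angles at which the cosines have opposite signs never exceed the bound. The maximum is attained at
  the angle with \<open>tan t0 * tan \<alpha> = u\<close>, where the cosines are positive and proportional to \<open>1 + u\<close>
  and \<open>1 - u\<close>. The Lipschitz bound for \<open>bias\<close> turns the quadratic loss in \<open>w - u\<close> into one in the
  bias.
\<close>

lemma spin_landscapeI:
  fixes \<beta> :: real
  defines "q \<equiv> exp (- 2 * \<beta>)"
  assumes "\<beta> > 0" "d \<ge> 1" "0 \<le> u" "u < 1" "c > 0"
    and max: "\<And>w. 0 \<le> w \<Longrightarrow> w \<le> 1 \<Longrightarrow> rate q d w \<le> rate q d u - c * (w - u)\<^sup>2"
  shows "\<exists>\<alpha> \<kappa> t0. spin_landscape d \<beta> \<alpha> (bias d u) \<kappa> t0"
proof -
  have q: "0 < q" "q < 1" using assms(2) by (auto simp: q_def)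
  define \<alpha> where "\<alpha> = arccos q / 2"
  have "0 < arccos q" "arccos q \<le> pi"
    using q arccos_less_arccos[of q 1] arccos_ubound[of q] by auto
  moreover have "arccos q < pi / 2"
    using q arccos_less_arccos[of 0 q] by auto
  ultimately have \<alpha>: "0 < \<alpha>" "\<alpha> < pi / 2" and cos_2\<alpha>: "cos (2 * \<alpha>) = q"
    using q by (auto simp: \<alpha>_def)
  have sc: "sin \<alpha> > 0" "cos \<alpha> > 0"
    using \<alpha> by (auto intro: sin_gt_zero cos_gt_zero)
  define K where "K = real d / 2 * ln ((1 - q\<^sup>2) / 2)"
  have q2: "q\<^sup>2 < 1" using q by (simp add: power_less_one_iff)
  have sum_pos: "\<bar>cos (t - \<alpha>)\<bar> + \<bar>cos (t + \<alpha>)\<bar> > 0" for t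
  proof (rule ccontr)
    assume "\<not> \<bar>cos (t - \<alpha>)\<bar> + \<bar>cos (t + \<alpha>)\<bar> > 0"
    then have "cos (t - \<alpha>) = 0" "cos (t + \<alpha>) = 0" by auto
    with cos_pair_ellipse[of t \<alpha>] cos_2\<alpha> q2 show False by simp
  qed
  define W where "W = (\<lambda>t. \<bar>\<bar>cos (t - \<alpha>)\<bar> - \<bar>cos (t + \<alpha>)\<bar>\<bar> / (\<bar>cos (t - \<alpha>)\<bar> + \<bar>cos (t + \<alpha>)\<bar>))"
  have lem: "0 \<le> W t" "W t \<le> 1" "spin_sum d \<alpha> t > 0" "\<bar>spin_bias d \<alpha> t\<bar> = bias d (W t)"
    "\<bar>cos (t - \<alpha>)\<bar>\<^sup>2 + \<bar>cos (t + \<alpha>)\<bar>\<^sup>2 - 2 * q * \<bar>cos (t - \<alpha>)\<bar> * \<bar>cos (t + \<alpha>)\<bar> \<le> 1 - q\<^sup>2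
      \<Longrightarrow> ln (spin_sum d \<alpha> t) \<le> rate q d (W t) + K"
    "\<bar>cos (t - \<alpha>)\<bar>\<^sup>2 + \<bar>cos (t + \<alpha>)\<bar>\<^sup>2 - 2 * q * \<bar>cos (t - \<alpha>)\<bar> * \<bar>cos (t + \<alpha>)\<bar> = 1 - q\<^sup>2
      \<Longrightarrow> ln (spin_sum d \<alpha> t) = rate q d (W t) + K" for t
    unfolding W_def spin_sum_def spin_bias_def K_def
    by (fact ln_power_sum_le[OF q abs_ge_zero abs_ge_zero sum_pos])+
  have le: "ln (spin_sum d \<alpha> t) \<le> rate q d (W t) + K" for t
  proof (rule lem(5))
    have "- (2 * q * \<bar>cos (t - \<alpha>)\<bar> * \<bar>cos (t + \<alpha>)\<bar>) \<le> - (2 * q * cos (t - \<alpha>) * cos (t + \<alpha>))"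
      using q abs_ge_self[of "cos (t - \<alpha>) * cos (t + \<alpha>)"] by (simp add: abs_mult mult.assoc)
    then show "\<bar>cos (t - \<alpha>)\<bar>\<^sup>2 + \<bar>cos (t + \<alpha>)\<bar>\<^sup>2 - 2 * q * \<bar>cos (t - \<alpha>)\<bar> * \<bar>cos (t + \<alpha>)\<bar> \<le> 1 - q\<^sup>2"
      using cos_pair_ellipse[of t \<alpha>] unfolding cos_2\<alpha> by simp
  qed
  define t0 where "t0 = arctan (u * cos \<alpha> / sin \<alpha>)"
  have t0: "0 \<le> t0" "t0 < pi / 2" "cos t0 > 0"
  proof -
    show "0 \<le> t0" "t0 < pi / 2" using assms(4) sc arctan_ubound by (auto simp: t0_def)
    then show "cos t0 > 0" by (intro cos_gt_zero_pi) auto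
  qed
  have "sin t0 = cos t0 * (u * cos \<alpha> / sin \<alpha>)"
    using t0(3) tan_arctan[of "u * cos \<alpha> / sin \<alpha>"]
    unfolding t0_def[symmetric] tan_def by (simp add: field_simps)
  then have sin_t0: "sin t0 * sin \<alpha> = cos t0 * cos \<alpha> * u"
    using sc by simp
  have c0: "cos (t0 - \<alpha>) = cos t0 * cos \<alpha> * (1 + u)" "cos (t0 + \<alpha>) = cos t0 * cos \<alpha> * (1 - u)"
    using sin_t0 by (simp_all add: cos_diff cos_add algebra_simps)
  have pos0: "cos (t0 - \<alpha>) > 0" "cos (t0 + \<alpha>) > 0"
    unfolding c0 using t0 sc assms by simp_all
  have "W t0 = u"
  proof -
    have "cos (t0 - \<alpha>) - cos (t0 + \<alpha>) = 2 * (cos t0 * cos \<alpha>) * u"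
      "cos (t0 - \<alpha>) + cos (t0 + \<alpha>) = 2 * (cos t0 * cos \<alpha>)"
      unfolding c0 by (simp_all add: algebra_simps)
    then show ?thesis
      unfolding W_def abs_of_pos[OF pos0(1)] abs_of_pos[OF pos0(2)] using t0 sc assms(4) by simp
  qed
  moreover have "ln (spin_sum d \<alpha> t0) = rate q d (W t0) + K"
    using cos_pair_ellipse[of t0 \<alpha>] pos0 unfolding cos_2\<alpha> by (intro lem(6)) simp
  ultimately have eq: "ln (spin_sum d \<alpha> t0) = rate q d u + K" by simp
  define \<kappa> where "\<kappa> = c / (real d)\<^sup>2"
  have u: "0 \<le> u" "u \<le> 1" using assms by auto
  have "spin_landscape d \<beta> \<alpha> (bias d u) \<kappa> t0"
  proof
    show "cos (2 * \<alpha>) = exp (- 2 * \<beta>)" using cos_2\<alpha> by (simp add: q_def)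
    show "\<kappa> > 0" using assms by (simp add: \<kappa>_def)
    have "(1 - u) ^ d \<le> (1 + u) ^ d" using u by (intro power_mono) auto
    then show "0 \<le> bias d u"
      using pow_sum_ge_2[OF u, of d] by (simp add: bias_def)
    fix t
    show "spin_sum d \<alpha> t > 0" by (rule lem(3))
    have "ln (spin_sum d \<alpha> t) \<le> ln (spin_sum d \<alpha> t0) - c * (W t - u)\<^sup>2"
      using le[of t] max[OF lem(1,2), of t] eq by linarith
    also have "\<dots> \<le> ln (spin_sum d \<alpha> t0) - \<kappa> * (\<bar>spin_bias d \<alpha> t\<bar> - bias d u)\<^sup>2"
    proof -
      have "\<bar>\<bar>spin_bias d \<alpha> t\<bar> - bias d u\<bar> \<le> real d * \<bar>W t - u\<bar>"
        unfolding lem(4) using bias_Lipschitz[OF assms(3) lem(1,2) u] .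
      then have "\<bar>\<bar>spin_bias d \<alpha> t\<bar> - bias d u\<bar>\<^sup>2 \<le> (real d * \<bar>W t - u\<bar>)\<^sup>2"
        by (intro power_mono) auto
      then have "\<kappa> * (\<bar>spin_bias d \<alpha> t\<bar> - bias d u)\<^sup>2 \<le> \<kappa> * ((real d)\<^sup>2 * (W t - u)\<^sup>2)"
        using assms by (intro mult_left_mono) (auto simp: \<kappa>_def power_mult_distrib)
      also have "\<dots> = c * (W t - u)\<^sup>2"
        using assms by (simp add: \<kappa>_def)
      finally show ?thesis by simp
    qed
    finally have "exp (ln (spin_sum d \<alpha> t))
        \<le> exp (ln (spin_sum d \<alpha> t0) - \<kappa> * (\<bar>spin_bias d \<alpha> t\<bar> - bias d u)\<^sup>2)"
      by simp
    then show "spin_sum d \<alpha> t \<le> spin_sum d \<alpha> t0 * exp (- \<kappa> * (\<bar>spin_bias d \<alpha> t\<bar> - bias d u)\<^sup>2)"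
      using lem(3)[of t] lem(3)[of t0] by (simp add: exp_diff exp_minus divide_inverse)
  qed (use assms t0 pos0 in auto)
  then show ?thesis by blast
qed

text \<open>Hoeffding's lemma for a variable with values \<open>1\<close> and \<open>-1\<close>.\<close>

lemma two_point_mgf_le:
  fixes a b s :: real
  assumes "a \<ge> 0" "b \<ge> 0" "a + b > 0" "s \<ge> 0"
  shows "a * exp s + b * exp (- s) \<le> (a + b) * exp (s * ((a - b) / (a + b)) + s\<^sup>2 / 2)"
proof -
  define p where "p = a / (a + b)"
  have p: "p \<ge> 0" "a = (a + b) * p" "b = (a + b) * (1 - p)" "(a - b) / (a + b) = 2 * p - 1"
    using assms by (auto simp: p_def field_simps)
  have pos: "1 + p * (exp (2 * s) - 1) > 0"
    using p assms by (intro add_pos_nonneg mult_nonneg_nonneg) auto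
  have "- (2 * s) * p + ln (1 + p * (exp (2 * s) - 1)) \<le> (2 * s)\<^sup>2 / 8"
    using Hoeffdings_lemma_aux[of "2 * s" p] p assms by simp
  then have "ln (1 + p * (exp (2 * s) - 1)) \<le> 2 * s * p + s\<^sup>2 / 2"
    by (simp add: power2_eq_square)
  then have "exp (ln (1 + p * (exp (2 * s) - 1))) \<le> exp (2 * s * p + s\<^sup>2 / 2)"
    by simp
  then have "1 + p * (exp (2 * s) - 1) \<le> exp (2 * s * p + s\<^sup>2 / 2)"
    using pos by simp
  then have "(a + b) * (exp (- s) * (1 + p * (exp (2 * s) - 1)))
      \<le> (a + b) * (exp (- s) * exp (2 * s * p + s\<^sup>2 / 2))"
    using assms by (intro mult_left_mono) auto
  moreover have "exp (- s) * (1 + p * (exp (2 * s) - 1)) = p * exp s + (1 - p) * exp (- s)"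
    by (simp add: algebra_simps flip: exp_add)
  then have "(a + b) * (exp (- s) * (1 + p * (exp (2 * s) - 1)))
      = ((a + b) * p) * exp s + ((a + b) * (1 - p)) * exp (- s)"
    by (simp only: distrib_left mult.assoc)
  moreover have "exp (- s) * exp (2 * s * p + s\<^sup>2 / 2) = exp (s * ((a - b) / (a + b)) + s\<^sup>2 / 2)"
    unfolding p(4) by (simp add: algebra_simps flip: exp_add)
  ultimately show ?thesis
    unfolding p(2)[symmetric] p(3)[symmetric] by simp
qed

section \<open>Exponential concentration of the magnetization\<close>

lemma sum_spin_configs_prod:
  "(\<Sum>\<sigma>\<in>spin_configs n. \<Prod>i=1..n. f i (\<sigma> i)) = (\<Prod>i=1..n. f i 1 + f i (-1) :: real)"
proof -
  have "(\<Prod>i=1..n. \<Sum>y\<in>{-1, 1}. f i y) = (\<Sum>\<sigma>\<in>spin_configs n. \<Prod>i=1..n. f i (\<sigma> i))"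
    unfolding spin_configs_def by (rule prod_sum_PiE) auto
  then show ?thesis by (simp add: add.commute)
qed

text \<open>
  Both tails are covered by the sign \<open>e\<close>. The exponential tilt with parameter \<open>\<delta>\<close> is the optimal one
  for the Gaussian bound on the moment generating function.
\<close>

lemma spin_chernoff:
  fixes z :: "real \<Rightarrow> real"
  assumes z: "z 1 \<ge> 0" "z (-1) \<ge> 0" "z 1 + z (-1) > 0" and "\<delta> \<ge> 0" and e: "e = 1 \<or> e = -1"
  defines "m \<equiv> (z 1 - z (-1)) / (z 1 + z (-1))"
  shows "(\<Sum>\<sigma> | \<sigma> \<in> spin_configs n \<and> e * total_spin n \<sigma> \<ge> real n * (e * m + \<delta>). \<Prod>i=1..n. z (\<sigma> i))
    \<le> (z 1 + z (-1)) ^ n * exp (- real n * \<delta>\<^sup>2 / 2)"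
proof -
  let ?A = "{\<sigma>. \<sigma> \<in> spin_configs n \<and> e * total_spin n \<sigma> \<ge> real n * (e * m + \<delta>)}"
  let ?c = "exp (- (\<delta> * real n * (e * m + \<delta>)))"
  have nonneg: "(\<Prod>i=1..n. z (\<sigma> i)) \<ge> 0" if "\<sigma> \<in> spin_configs n" for \<sigma>
    using spin_values[OF that] z by (intro prod_nonneg) fastforce
  have tilt: "(\<Prod>i=1..n. z (\<sigma> i)) * exp (\<delta> * e * total_spin n \<sigma>) = (\<Prod>i=1..n. z (\<sigma> i) * exp (\<delta> * e * \<sigma> i))"
    for \<sigma>
    by (simp add: total_spin_def sum_distrib_left exp_sum prod.distrib)
  have "(\<Sum>\<sigma>\<in>?A. \<Prod>i=1..n. z (\<sigma> i))
      \<le> (\<Sum>\<sigma>\<in>?A. ?c * ((\<Prod>i=1..n. z (\<sigma> i)) * exp (\<delta> * e * total_spin n \<sigma>)))"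
  proof (rule sum_mono)
    fix \<sigma> assume \<sigma>: "\<sigma> \<in> ?A"
    then have "\<delta> * (real n * (e * m + \<delta>)) \<le> \<delta> * (e * total_spin n \<sigma>)"
      using assms(4) by (intro mult_left_mono) auto
    then have "1 \<le> ?c * exp (\<delta> * e * total_spin n \<sigma>)"
      by (simp add: mult.assoc flip: exp_add)
    from mult_left_mono[OF this nonneg] \<sigma>
    show "(\<Prod>i=1..n. z (\<sigma> i)) \<le> ?c * ((\<Prod>i=1..n. z (\<sigma> i)) * exp (\<delta> * e * total_spin n \<sigma>))"
      by (simp add: mult_ac)
  qed
  also have "\<dots> \<le> (\<Sum>\<sigma>\<in>spin_configs n. ?c * ((\<Prod>i=1..n. z (\<sigma> i)) * exp (\<delta> * e * total_spin n \<sigma>)))"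
    using nonneg by (intro sum_mono2) auto
  also have "\<dots> = ?c * (z 1 * exp (\<delta> * e) + z (-1) * exp (- (\<delta> * e))) ^ n"
    unfolding tilt sum_distrib_left[symmetric]
    using sum_spin_configs_prod[of "\<lambda>i y. z y * exp (\<delta> * e * y)" n] by simp
  also have "\<dots> \<le> ?c * ((z 1 + z (-1)) * exp (\<delta> * (e * m) + \<delta>\<^sup>2 / 2)) ^ n"
  proof -
    have "z 1 * exp (\<delta> * e) + z (-1) * exp (- (\<delta> * e)) \<le> (z 1 + z (-1)) * exp (\<delta> * (e * m) + \<delta>\<^sup>2 / 2)"
      using e
    proof
      assume "e = 1"
      then show ?thesis
        using two_point_mgf_le[of "z 1" "z (-1)" \<delta>] assms by (simp add: m_def)
    next
      assume e: "e = -1"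
      have "(z (-1) - z 1) / (z (-1) + z 1) = - m"
        by (simp add: m_def add.commute minus_divide_left)
      then show ?thesis
        using two_point_mgf_le[of "z (-1)" "z 1" \<delta>] assms(4) z e by (simp add: add.commute)
    qed
    then show ?thesis
      using z by (intro mult_left_mono power_mono) (auto intro: add_nonneg_nonneg mult_nonneg_nonneg)
  qed
  also have "\<dots> = (z 1 + z (-1)) ^ n * exp (- real n * \<delta>\<^sup>2 / 2)"
  proof -
    have "?c * ((z 1 + z (-1)) * exp (\<delta> * (e * m) + \<delta>\<^sup>2 / 2)) ^ n
        = (z 1 + z (-1)) ^ n * (?c * exp (real n * (\<delta> * (e * m) + \<delta>\<^sup>2 / 2)))"
      unfolding exp_of_nat_mult power_mult_distrib by (simp only: mult.left_commute)
    also have "?c * exp (real n * (\<delta> * (e * m) + \<delta>\<^sup>2 / 2)) = exp (- real n * \<delta>\<^sup>2 / 2)"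
      unfolding exp_add[symmetric] by (simp add: power2_eq_square algebra_simps)
    finally show ?thesis .
  qed
  finally show ?thesis .
qed

definition off_target :: "nat \<Rightarrow> real \<Rightarrow> real \<Rightarrow> (nat \<Rightarrow> real) set" where
  "off_target n \<nu> \<epsilon> = {\<sigma> \<in> spin_configs n. \<bar>\<bar>total_spin n \<sigma> / real n\<bar> - \<nu>\<bar> > \<epsilon>}"

lemma off_target_subset: "off_target n \<nu> \<epsilon> \<subseteq> spin_configs n"
  by (auto simp: off_target_def)

lemma finite_off_target [simp]: "finite (off_target n \<nu> \<epsilon>)"
  by (rule finite_subset[OF off_target_subset]) simp

lemma abs_cos_diff_le: "\<bar>cos x - cos y\<bar> \<le> \<bar>x - y :: real\<bar>"
proof -
  have "\<bar>cos x - cos y\<bar> = 2 * \<bar>sin ((x + y) / 2)\<bar> * \<bar>sin ((y - x) / 2)\<bar>"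
    by (simp add: cos_diff_cos abs_mult)
  also have "\<dots> \<le> 2 * 1 * \<bar>(y - x) / 2\<bar>"
    by (intro mult_mono abs_sin_x_le_abs_x) auto
  finally show ?thesis by simp
qed

lemma cos_power_ge: "cos (x :: real) ^ k \<ge> cos y ^ k - real k * \<bar>x - y\<bar>"
proof -
  have "\<bar>cos y ^ k - cos x ^ k\<bar> \<le> real k * \<bar>cos y - cos x\<bar>"
    using norm_power_diff[of "cos y" "cos x" k] by simp
  also have "\<dots> \<le> real k * \<bar>y - x\<bar>"
    by (intro mult_left_mono abs_cos_diff_le) simp
  finally show ?thesis by (simp add: abs_minus_commute)
qed

lemma continuous_spin_integrand [continuous_intros]:
  fixes \<alpha> :: real
  shows "continuous_on S (\<lambda>t. \<Prod>i=1..n. cos (t - \<sigma> i * \<alpha>) ^ vertex_degree d n i)"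
  by (intro continuous_on_prod continuous_on_power continuous_on_cos continuous_on_diff
      continuous_on_id continuous_on_const)

lemma sum_spin_integral:
  "(\<Sum>\<sigma>\<in>spin_configs n. spin_integral d n \<alpha> \<sigma>) =
    integral {0..2*pi} (\<lambda>t. \<Prod>i=1..n. cos (t - \<alpha>) ^ vertex_degree d n i + cos (t + \<alpha>) ^ vertex_degree d n i)"
proof -
  have "(\<Sum>\<sigma>\<in>spin_configs n. spin_integral d n \<alpha> \<sigma>) =
      integral {0..2*pi} (\<lambda>t. \<Sum>\<sigma>\<in>spin_configs n. \<Prod>i=1..n. cos (t - \<sigma> i * \<alpha>) ^ vertex_degree d n i)"
    unfolding spin_integral_def
    by (rule integral_sum[symmetric]) (auto intro!: integrable_continuous_real continuous_intros)
  also have "(\<lambda>t. \<Sum>\<sigma>\<in>spin_configs n. \<Prod>i=1..n. cos (t - \<sigma> i * \<alpha>) ^ vertex_degree d n i)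
      = (\<lambda>t. \<Prod>i=1..n. cos (t - \<alpha>) ^ vertex_degree d n i + cos (t + \<alpha>) ^ vertex_degree d n i)"
  proof
    fix t
    show "(\<Sum>\<sigma>\<in>spin_configs n. \<Prod>i=1..n. cos (t - \<sigma> i * \<alpha>) ^ vertex_degree d n i)
        = (\<Prod>i=1..n. cos (t - \<alpha>) ^ vertex_degree d n i + cos (t + \<alpha>) ^ vertex_degree d n i)"
      using sum_spin_configs_prod[of "\<lambda>i y. cos (t - y * \<alpha>) ^ vertex_degree d n i" n] by simp
  qed
  finally show ?thesis .
qed

lemma prod_vertex_degree:
  assumes "n \<ge> 1"
  shows "(\<Prod>i=1..n. f (vertex_degree d n i)) = f d ^ (n - 1) * (f (vertex_degree d n n) :: real)"
proof -
  have "{1..n} = insert n {1..<n}"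
    using assms by auto
  then have "(\<Prod>i=1..n. f (vertex_degree d n i)) = f (vertex_degree d n n) * (\<Prod>i=1..<n. f (vertex_degree d n i))"
    by simp
  also have "(\<Prod>i=1..<n. f (vertex_degree d n i)) = (\<Prod>i=1..<n. f d)"
    by (intro prod.cong) (auto simp: vertex_degree_def)
  finally show ?thesis by (simp add: mult.commute)
qed

text \<open>
  Parity makes the integrand of the partition function nonnegative: if \<open>d\<close> is odd, then either \<open>n\<close> is
  even, or there are \<open>n - 1\<close> equal factors, an even number, and one vertex of even degree \<open>d + 1\<close>.
\<close>

lemma prod_vertex_degree_nonneg:
  assumes "n \<ge> 1"
  shows "(\<Prod>i=1..n. x ^ vertex_degree d n i + y ^ vertex_degree d n i) \<ge> (0 :: real)"
proof (cases "even d")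
  case True
  then show ?thesis
    by (intro prod_nonneg) (auto simp: vertex_degree_def)
next
  case False
  show ?thesis
  proof (cases "even n")
    case True
    then have "vertex_degree d n n = d" by (simp add: vertex_degree_def)
    then have "(\<Prod>i=1..n. x ^ vertex_degree d n i + y ^ vertex_degree d n i) = (x ^ d + y ^ d) ^ n"
      using assms prod_vertex_degree[OF assms, of "\<lambda>k. x ^ k + y ^ k" d]
      by (simp flip: power_Suc2)
    then show ?thesis using True by (simp add: zero_le_even_power)
  next
    case odd: False
    then have "vertex_degree d n n = d + 1" "even (n - 1)"
      using False assms by (auto simp: vertex_degree_def)
    moreover have "(x ^ d + y ^ d) ^ (n - 1) \<ge> 0" "x ^ (d + 1) + y ^ (d + 1) \<ge> 0"
      using \<open>even (n - 1)\<close> False by (auto intro!: add_nonneg_nonneg zero_le_even_power simp del: power_Suc)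
    ultimately show ?thesis
      using prod_vertex_degree[OF assms, of "\<lambda>k. x ^ k + y ^ k" d] by simp
  qed
qed

context spin_landscape
begin

abbreviation peak :: real where "peak \<equiv> spin_sum d \<alpha> t0"

lemma peak_eq: "peak = cos (t0 - \<alpha>) ^ d + cos (t0 + \<alpha>) ^ d"
  using t0 by (simp add: spin_sum_def)

lemma peak_pos: "peak > 0" by (rule spin_sum_pos)

lemma peak_le_2: "peak \<le> 2"
  using power_le_one[of "cos (t0 - \<alpha>)" d] power_le_one[of "cos (t0 + \<alpha>)" d] t0
  by (simp add: peak_eq)

text \<open>
  As the integrand is nonnegative, its part over an interval of length proportional to \<open>1 / n\<close> next to \<open>t0\<close>
  is a lower bound. On this interval each factor is at least \<open>1 - 1 / (2 * n)\<close> times its value at \<open>t0\<close>, by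
  Lipschitz continuity, and Bernoulli's inequality keeps the product of these losses above \<open>1 / 2\<close>. The
  vertex of exceptional degree only costs a constant.
\<close>

lemma partition_integral_lower_bound:
  obtains c where "c > 0"
    "\<And>n. n \<ge> 1 \<Longrightarrow> (\<Sum>\<sigma>\<in>spin_configs n. spin_integral d n \<alpha> \<sigma>) \<ge> c * peak ^ n / real n"
proof -
  define peak1 where "peak1 = cos (t0 - \<alpha>) ^ (d + 1) + cos (t0 + \<alpha>) ^ (d + 1)"
  define G where "G = min peak peak1"
  have G: "G > 0" "G \<le> 2"
    using t0 peak_pos peak_le_2 unfolding G_def peak1_def by (auto intro!: add_pos_pos)
  \<comment> \<open>Powers of the cosines up to \<open>d + 1\<close> have Lipschitz constant at most \<open>d + 1\<close>, and there are two of them.\<close>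
  define \<delta> where "\<delta> = G / (4 * (real d + 1))"
  have \<delta>: "\<delta> > 0" using G by (simp add: \<delta>_def)
  have \<delta>_le: "\<delta> \<le> 1 / 4"
    using G d_pos by (simp add: \<delta>_def field_simps)
  have bound: "\<delta> * peak ^ n * G / (8 * real n) \<le> (\<Sum>\<sigma>\<in>spin_configs n. spin_integral d n \<alpha> \<sigma>)" if n: "n \<ge> 1" for n
  proof -
    let ?f = "\<lambda>t k. cos (t - \<alpha>) ^ k + cos (t + \<alpha>) ^ k"
    let ?T = "\<lambda>t. \<Prod>i=1..n. ?f t (vertex_degree d n i)"
    define b where "b = t0 + \<delta> / real n"
    have \<delta>n: "\<delta> / real n > 0" "\<delta> / real n \<le> 1 / 4"
      using \<delta> \<delta>_le n by (auto simp: field_simps) 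
    have b: "t0 \<le> b" "b \<le> 2 * pi"
      using \<delta>n t0 pi_gt3 unfolding b_def by linarith+
    have near: "?f t k \<ge> ?f t0 k - G / (2 * real n)" if t: "t \<in> {t0..b}" and k: "k \<le> d + 1" for t k
    proof -
      have "real k * \<bar>t - t0\<bar> \<le> (real d + 1) * (\<delta> / real n)"
        using t k by (intro mult_mono) (auto simp: b_def)
      also have "\<dots> = G / (4 * real n)"
      proof -
        define r where "r = real d + 1"
        have "r > 0" by (simp add: r_def)
        then show ?thesis unfolding \<delta>_def r_def[symmetric] by (simp add: field_simps)
      qed
      finally have "real k * \<bar>t - t0\<bar> \<le> G / (4 * real n)" .
      then show ?thesis
        using cos_power_ge[where x = "t - \<alpha>" and y = "t0 - \<alpha>" and k = k]
          cos_power_ge[where x = "t + \<alpha>" and y = "t0 + \<alpha>" and k = k]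
        by simp
    qed
    have T_ge: "?T t \<ge> peak ^ n * G / 8" if t: "t \<in> {t0..b}" for t
    proof -
      have n2: "1 / (2 * real n) \<le> 1 / 2" using n by (simp add: field_simps)
      have "peak * (1 - 1 / (2 * real n)) \<le> peak - G / (2 * real n)"
        using n by (simp add: G_def right_diff_distrib divide_right_mono)
      also have "\<dots> \<le> ?f t d"
        using near[OF t, of d] by (simp add: peak_eq)
      finally have fd: "peak * (1 - 1 / (2 * real n)) \<le> ?f t d" .
      have "1 / 2 \<le> 1 - real (n - 1) * (1 / (2 * real n))"
        using n by (simp add: field_simps of_nat_diff)
      also have "\<dots> \<le> (1 - 1 / (2 * real n)) ^ (n - 1)"
        using Bernoulli_inequality[of "- (1 / (2 * real n))" "n - 1"] n2 by simp
      finally have bern: "1 / 2 \<le> (1 - 1 / (2 * real n)) ^ (n - 1)" .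
      have "peak ^ (n - 1) * (1 / 2) \<le> (peak * (1 - 1 / (2 * real n))) ^ (n - 1)"
        unfolding power_mult_distrib using peak_pos bern by (intro mult_left_mono) auto
      also have "\<dots> \<le> ?f t d ^ (n - 1)"
        using fd peak_pos n2 by (intro power_mono mult_nonneg_nonneg) auto
      finally have main: "peak ^ (n - 1) * (1 / 2) \<le> ?f t d ^ (n - 1)" .
      have "G \<le> ?f t0 (vertex_degree d n n)"
        using peak_eq by (auto simp: vertex_degree_def G_def peak1_def)
      moreover have "G / (2 * real n) \<le> G / 2"
        using n G by (simp add: field_simps)
      moreover have "vertex_degree d n n \<le> d + 1"
        by (simp add: vertex_degree_def)
      ultimately have last: "G / 2 \<le> ?f t (vertex_degree d n n)"
        using near[OF t, of "vertex_degree d n n"] by linarith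
      have "peak ^ n = peak ^ (n - 1) * peak"
        using n by (cases n) auto
      also have "\<dots> \<le> peak ^ (n - 1) * 2"
        using peak_le_2 peak_pos by (intro mult_left_mono) auto
      finally have "peak ^ n * G / 8 \<le> peak ^ (n - 1) * 2 * G / 8"
        using G by (intro divide_right_mono mult_right_mono) auto
      also have "\<dots> = (peak ^ (n - 1) * (1 / 2)) * (G / 2)" by simp
      also have "\<dots> \<le> ?f t d ^ (n - 1) * ?f t (vertex_degree d n n)"
      proof (rule mult_mono[OF main last])
        show "0 \<le> ?f t d ^ (n - 1)"
          by (rule order_trans[OF _ main]) (use peak_pos in simp)
      qed (use G in simp)
      finally show ?thesis
        unfolding prod_vertex_degree[OF n, of "?f t"] .
    qed
    have int: "?T integrable_on {x..y}" for x y
      by (intro integrable_continuous_real continuous_intros)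
    have "\<delta> * peak ^ n * G / (8 * real n) = integral {t0..b} (\<lambda>t. peak ^ n * G / 8)"
      using b by (simp add: b_def mult_ac)
    also have "\<dots> \<le> integral {t0..b} ?T"
      using T_ge int by (intro integral_le) auto
    also have "\<dots> \<le> integral {0..2*pi} ?T"
      using b t0 int prod_vertex_degree_nonneg[OF n] by (intro integral_subset_le) auto
    finally show ?thesis by (simp only: sum_spin_integral)
  qed
  show ?thesis
  proof (rule that)
    show "\<delta> * G / 8 > 0" using \<delta> G by simp
    show "(\<Sum>\<sigma>\<in>spin_configs n. spin_integral d n \<alpha> \<sigma>) \<ge> \<delta> * G / 8 * peak ^ n / real n" if "n \<ge> 1" for n
      using bound[OF that] by (simp add: mult_ac)
  qed
qed

text \<open>The smaller of the two rates in \<open>off_target_pointwise\<close>.\<close>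

definition decay :: real where "decay = min (\<kappa> / 4) (1 / 8)"

lemma decay_pos: "decay > 0"
  using kappa_pos by (simp add: decay_def)

text \<open>
  At a given angle there are two reasons for a deviation by \<open>\<epsilon>\<close>: either the bias at this angle is
  at least \<open>\<epsilon> / 2\<close> away from \<open>\<nu>\<close>, and then the angle has an exponentially small total weight, or
  the spins deviate by \<open>\<epsilon> / 2\<close> from their mean, to which Hoeffding's bound applies.
\<close>

lemma off_target_pointwise:
  assumes "n \<ge> 1" "\<epsilon> \<ge> 0"
  shows "(\<Sum>\<sigma>\<in>off_target n \<nu> \<epsilon>. \<Prod>i=1..n. \<bar>cos (t - \<sigma> i * \<alpha>)\<bar> ^ d)
    \<le> 3 * peak ^ n * exp (- decay * real n * \<epsilon>\<^sup>2)"
proof -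
  define z where "z = (\<lambda>y. \<bar>cos (t - y * \<alpha>)\<bar> ^ d)"
  have z: "z 1 \<ge> 0" "z (-1) \<ge> 0" and z_sum: "z 1 + z (-1) = spin_sum d \<alpha> t"
    and z_bias: "(z 1 - z (-1)) / (z 1 + z (-1)) = spin_bias d \<alpha> t"
    by (auto simp: z_def spin_sum_def spin_bias_def)
  have nonneg: "(\<Prod>i=1..n. z (\<sigma> i)) \<ge> 0" for \<sigma>
    by (intro prod_nonneg) (simp add: z_def)
  have le_peak: "spin_sum d \<alpha> t \<le> peak"
  proof -
    have "spin_sum d \<alpha> t \<le> peak * exp (- \<kappa> * (\<bar>spin_bias d \<alpha> t\<bar> - \<nu>)\<^sup>2)" by (rule spin_sum_le)
    also have "\<dots> \<le> peak * 1" using peak_pos kappa_pos by (intro mult_left_mono) auto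
    finally show ?thesis by simp
  qed
  have weaken: "exp (- a * real n * \<epsilon>\<^sup>2) \<le> exp (- decay * real n * \<epsilon>\<^sup>2)" if "decay \<le> a" for a
    using that by (simp add: mult_right_mono)
  have "(\<Sum>\<sigma>\<in>off_target n \<nu> \<epsilon>. \<Prod>i=1..n. z (\<sigma> i)) \<le> 3 * peak ^ n * exp (- decay * real n * \<epsilon>\<^sup>2)"
  proof (cases "\<bar>\<bar>spin_bias d \<alpha> t\<bar> - \<nu>\<bar> \<ge> \<epsilon> / 2")
    case True
    then have "(\<epsilon> / 2)\<^sup>2 \<le> \<bar>\<bar>spin_bias d \<alpha> t\<bar> - \<nu>\<bar>\<^sup>2"
      using assms by (intro power_mono) auto
    then have sq: "\<kappa> * (\<epsilon>\<^sup>2 / 4) \<le> \<kappa> * (\<bar>spin_bias d \<alpha> t\<bar> - \<nu>)\<^sup>2"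
      using kappa_pos by (simp add: power_divide)
    have "(\<Sum>\<sigma>\<in>off_target n \<nu> \<epsilon>. \<Prod>i=1..n. z (\<sigma> i)) \<le> (\<Sum>\<sigma>\<in>spin_configs n. \<Prod>i=1..n. z (\<sigma> i))"
      using off_target_subset nonneg by (intro sum_mono2) auto
    also have "\<dots> = spin_sum d \<alpha> t ^ n"
      using sum_spin_configs_prod[of "\<lambda>i. z" n] by (simp add: z_sum)
    also have "\<dots> \<le> (peak * exp (- (\<kappa> * (\<epsilon>\<^sup>2 / 4)))) ^ n"
    proof (rule power_mono)
      have "spin_sum d \<alpha> t \<le> peak * exp (- \<kappa> * (\<bar>spin_bias d \<alpha> t\<bar> - \<nu>)\<^sup>2)" by (rule spin_sum_le)
      also have "\<dots> \<le> peak * exp (- (\<kappa> * (\<epsilon>\<^sup>2 / 4)))"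
        using sq peak_pos by (intro mult_left_mono) auto
      finally show "spin_sum d \<alpha> t \<le> peak * exp (- (\<kappa> * (\<epsilon>\<^sup>2 / 4)))" .
    qed (use spin_sum_pos[of t] in simp)
    also have "\<dots> = peak ^ n * exp (- (\<kappa> / 4) * real n * \<epsilon>\<^sup>2)"
      by (simp add: power_mult_distrib mult_ac flip: exp_of_nat_mult)
    also have "\<dots> \<le> peak ^ n * exp (- decay * real n * \<epsilon>\<^sup>2)"
      using peak_pos by (intro mult_left_mono weaken) (auto simp: decay_def)
    also have "\<dots> \<le> 3 * (peak ^ n * exp (- decay * real n * \<epsilon>\<^sup>2))"
      using peak_pos by simp
    finally show ?thesis by (simp add: mult.assoc)
  next
    case False
    define m where "m = spin_bias d \<alpha> t"
    let ?A = "\<lambda>e. {\<sigma>. \<sigma> \<in> spin_configs n \<and> e * total_spin n \<sigma> \<ge> real n * (e * m + \<epsilon> / 2)}"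
    have "off_target n \<nu> \<epsilon> \<subseteq> ?A 1 \<union> ?A (-1)"
    proof
      fix \<sigma> assume \<sigma>: "\<sigma> \<in> off_target n \<nu> \<epsilon>"
      define s where "s = total_spin n \<sigma> / real n"
      have S: "total_spin n \<sigma> = real n * s" using assms by (simp add: s_def)
      have "\<bar>\<bar>s\<bar> - \<nu>\<bar> > \<epsilon>" using \<sigma> by (simp add: off_target_def s_def)
      with False have "\<bar>s - m\<bar> \<ge> \<epsilon> / 2" unfolding m_def[symmetric] by linarith
      then have "s \<ge> m + \<epsilon> / 2 \<or> - s \<ge> - m + \<epsilon> / 2" by linarith
      moreover have "real n * s \<ge> real n * (m + \<epsilon> / 2)" if "s \<ge> m + \<epsilon> / 2"
        using that by (intro mult_left_mono) auto
      moreover have "real n * (- s) \<ge> real n * (- m + \<epsilon> / 2)" if "- s \<ge> - m + \<epsilon> / 2"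
        using that by (intro mult_left_mono) auto
      ultimately show "\<sigma> \<in> ?A 1 \<union> ?A (-1)"
        using \<sigma> off_target_subset[of n \<nu> \<epsilon>] by (auto simp: S)
    qed
    then have "(\<Sum>\<sigma>\<in>off_target n \<nu> \<epsilon>. \<Prod>i=1..n. z (\<sigma> i)) \<le> (\<Sum>\<sigma>\<in>?A 1 \<union> ?A (-1). \<Prod>i=1..n. z (\<sigma> i))"
      using nonneg by (intro sum_mono2) auto
    also have "\<dots> \<le> (\<Sum>\<sigma>\<in>?A 1. \<Prod>i=1..n. z (\<sigma> i)) + (\<Sum>\<sigma>\<in>?A (-1). \<Prod>i=1..n. z (\<sigma> i))"
      using nonneg by (subst sum_Un) (auto intro: sum_nonneg)
    also have "\<dots> \<le> spin_sum d \<alpha> t ^ n * exp (- real n * (\<epsilon> / 2)\<^sup>2 / 2)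
        + spin_sum d \<alpha> t ^ n * exp (- real n * (\<epsilon> / 2)\<^sup>2 / 2)"
      using spin_chernoff[of z "\<epsilon> / 2" 1 n] spin_chernoff[of z "\<epsilon> / 2" "-1" n] z spin_sum_pos[of t] assms
      unfolding z_bias unfolding z_sum m_def by (intro add_mono) auto
    also have "\<dots> = 2 * (spin_sum d \<alpha> t ^ n * exp (- (1 / 8) * real n * \<epsilon>\<^sup>2))"
      by (simp add: power_divide mult_ac)
    also have "\<dots> \<le> 2 * (peak ^ n * exp (- decay * real n * \<epsilon>\<^sup>2))"
      using le_peak spin_sum_pos[of t] peak_pos
      by (intro mult_left_mono mult_mono power_mono weaken) (auto simp: decay_def)
    also have "\<dots> \<le> 3 * (peak ^ n * exp (- decay * real n * \<epsilon>\<^sup>2))"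
      using peak_pos by simp
    finally show ?thesis by (simp add: mult.assoc)
  qed
  then show ?thesis by (simp add: z_def)
qed

lemma off_target_integral_bound:
  assumes "n \<ge> 1" "\<epsilon> \<ge> 0"
  shows "(\<Sum>\<sigma>\<in>off_target n \<nu> \<epsilon>. spin_integral d n \<alpha> \<sigma>)
    \<le> 6 * pi * peak ^ n * exp (- decay * real n * \<epsilon>\<^sup>2)"
proof -
  let ?g = "\<lambda>t. \<Sum>\<sigma>\<in>off_target n \<nu> \<epsilon>. \<Prod>i=1..n. cos (t - \<sigma> i * \<alpha>) ^ vertex_degree d n i"
  let ?C = "3 * peak ^ n * exp (- decay * real n * \<epsilon>\<^sup>2)"
  have "(\<Sum>\<sigma>\<in>off_target n \<nu> \<epsilon>. spin_integral d n \<alpha> \<sigma>) = integral {0..2*pi} ?g"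
    unfolding spin_integral_def
    by (rule integral_sum[symmetric]) (auto intro!: integrable_continuous_real continuous_intros)
  also have "\<dots> \<le> integral {0..2*pi} (\<lambda>t. ?C)"
  proof (rule integral_le)
    show "?g integrable_on {0..2*pi}"
      by (intro integrable_continuous_real continuous_intros)
    fix t
    have "?g t \<le> (\<Sum>\<sigma>\<in>off_target n \<nu> \<epsilon>. \<Prod>i=1..n. \<bar>cos (t - \<sigma> i * \<alpha>)\<bar> ^ d)"
    proof (rule sum_mono)
      fix \<sigma>
      have "(\<Prod>i=1..n. cos (t - \<sigma> i * \<alpha>) ^ vertex_degree d n i)
          \<le> (\<Prod>i=1..n. \<bar>cos (t - \<sigma> i * \<alpha>)\<bar> ^ vertex_degree d n i)"
        by (rule order_trans[OF abs_ge_self]) (simp add: abs_prod power_abs)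
      also have "\<dots> \<le> (\<Prod>i=1..n. \<bar>cos (t - \<sigma> i * \<alpha>)\<bar> ^ d)"
        by (intro prod_mono) (auto simp: vertex_degree_def intro!: mult_left_le_one_le)
      finally show "(\<Prod>i=1..n. cos (t - \<sigma> i * \<alpha>) ^ vertex_degree d n i) \<le> (\<Prod>i=1..n. \<bar>cos (t - \<sigma> i * \<alpha>)\<bar> ^ d)" .
    qed
    also have "\<dots> \<le> ?C" by (rule off_target_pointwise[OF assms])
    finally show "?g t \<le> ?C" .
  qed auto
  also have "\<dots> = 6 * pi * peak ^ n * exp (- decay * real n * \<epsilon>\<^sup>2)"
    by simp
  finally show ?thesis .
qed

lemma off_target_weight:
  obtains C where "C > 0"
    "\<And>n \<epsilon>. n \<ge> 1 \<Longrightarrow> \<epsilon> \<ge> 0 \<Longrightarrow>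
      (\<Sum>\<sigma>\<in>off_target n \<nu> \<epsilon>. spin_integral d n \<alpha> \<sigma>)
      \<le> C * real n * exp (- decay * real n * \<epsilon>\<^sup>2) * (\<Sum>\<sigma>\<in>spin_configs n. spin_integral d n \<alpha> \<sigma>)"
    "\<And>n. n \<ge> 1 \<Longrightarrow> (\<Sum>\<sigma>\<in>spin_configs n. spin_integral d n \<alpha> \<sigma>) > 0"
proof -
  obtain c where c: "c > 0" and lower:
    "\<And>n. n \<ge> 1 \<Longrightarrow> (\<Sum>\<sigma>\<in>spin_configs n. spin_integral d n \<alpha> \<sigma>) \<ge> c * peak ^ n / real n"
    using partition_integral_lower_bound by blast
  show ?thesis
  proof (rule that)
    show "6 * pi / c > 0" using c by simp
    fix n :: nat assume n: "n \<ge> 1"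
    let ?Z = "\<Sum>\<sigma>\<in>spin_configs n. spin_integral d n \<alpha> \<sigma>"
    have "c * peak ^ n / real n > 0" using c peak_pos n by simp
    with lower[OF n] show "?Z > 0" by linarith
    fix \<epsilon> :: real assume \<epsilon>: "\<epsilon> \<ge> 0"
    let ?x = "exp (- decay * real n * \<epsilon>\<^sup>2)"
    have "(\<Sum>\<sigma>\<in>off_target n \<nu> \<epsilon>. spin_integral d n \<alpha> \<sigma>) \<le> 6 * pi * peak ^ n * ?x"
      by (rule off_target_integral_bound[OF n \<epsilon>])
    also have "\<dots> = 6 * pi / c * real n * ?x * (c * peak ^ n / real n)"
      using c n by (simp add: field_simps)
    also have "\<dots> \<le> 6 * pi / c * real n * ?x * ?Z"
      using c by (intro mult_left_mono lower[OF n]) auto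
    finally show "(\<Sum>\<sigma>\<in>off_target n \<nu> \<epsilon>. spin_integral d n \<alpha> \<sigma>) \<le> 6 * pi / c * real n * ?x * ?Z" .
  qed
qed

end

section \<open>Spontaneous magnetization and the two phases\<close>

definition spin_flip :: "nat \<Rightarrow> (nat \<Rightarrow> real) \<Rightarrow> nat \<Rightarrow> real" where
  "spin_flip n \<sigma> = restrict (\<lambda>i. - \<sigma> i) {1..n}"

lemma spin_flip_in: "\<sigma> \<in> spin_configs n \<Longrightarrow> spin_flip n \<sigma> \<in> spin_configs n"
  by (auto simp: spin_flip_def spin_configs_def)

lemma spin_flip_flip: "\<sigma> \<in> spin_configs n \<Longrightarrow> spin_flip n (spin_flip n \<sigma>) = \<sigma>"
  by (auto simp: spin_flip_def spin_configs_def PiE_def extensional_def restrict_def)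

lemma total_spin_flip: "total_spin n (spin_flip n \<sigma>) = - total_spin n \<sigma>"
  by (simp add: total_spin_def spin_flip_def sum_negf)

lemma annealed_weight_flip: "annealed_weight d n \<beta> 0 (spin_flip n \<sigma>) = annealed_weight d n \<beta> 0 \<sigma>"
proof -
  have "hamiltonian n \<beta> 0 M (spin_flip n \<sigma>) = hamiltonian n \<beta> 0 M \<sigma>" for M
    unfolding hamiltonian_def
    by (simp, intro disjI2 sum.cong) (auto simp: spin_flip_def)
  then show ?thesis by (simp add: annealed_weight_def)
qed

lemma abs_total_spin_le:
  assumes "\<sigma> \<in> spin_configs n"
  shows "\<bar>total_spin n \<sigma>\<bar> \<le> real n"
proof -
  have "\<bar>total_spin n \<sigma>\<bar> \<le> (\<Sum>i=1..n. \<bar>\<sigma> i\<bar>)"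
    unfolding total_spin_def by (rule sum_abs)
  also have "\<dots> \<le> (\<Sum>i=1..n. 1)"
    using spin_values[OF assms] by (intro sum_mono) fastforce
  finally show ?thesis by simp
qed

context spin_landscape
begin

lemma annealed_weight_nonneg:
  assumes "n \<ge> 1" "\<sigma> \<in> spin_configs n"
  shows "annealed_weight d n \<beta> B \<sigma> \<ge> 0"
  unfolding annealed_weight_eq[OF assms(1) angle assms(2)]
  using spin_integral_nonneg[OF assms(1) angle] assms(2)
  by (intro divide_nonneg_nonneg sum_nonneg mult_nonneg_nonneg) auto

lemma measure_annealed:
  assumes "n \<ge> 1" "X \<subseteq> spin_configs n"
  shows "measure (annealed_measure d n \<beta> B) X = (\<Sum>\<sigma>\<in>X. annealed_weight d n \<beta> B \<sigma>)"
  unfolding annealed_measure_def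
  using assms annealed_weight_nonneg[OF assms(1)]
  by (subst measure_point_measure_finite_if) auto

text \<open>
  Since \<open>\<bar>S\<^sub>n\<bar> \<le> n\<close>, a field \<open>B\<close> multiplies the weight of each configuration by a factor between
  \<open>exp (- B * n)\<close> and \<open>exp (B * n)\<close>.
\<close>

lemma off_target_tilted:
  obtains C where "C > 0"
    "\<And>n B \<epsilon>. n \<ge> 1 \<Longrightarrow> B \<ge> 0 \<Longrightarrow> \<epsilon> \<ge> 0 \<Longrightarrow>
      (\<Sum>\<sigma>\<in>off_target n \<nu> \<epsilon>. annealed_weight d n \<beta> B \<sigma>)
      \<le> C * real n * exp ((2 * B - decay * \<epsilon>\<^sup>2) * real n)"
    "\<And>n B. n \<ge> 1 \<Longrightarrow> (\<Sum>\<sigma>\<in>spin_configs n. annealed_weight d n \<beta> B \<sigma>) = 1"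
proof -
  obtain C where C: "C > 0" and off: "\<And>n \<epsilon>. n \<ge> 1 \<Longrightarrow> \<epsilon> \<ge> 0 \<Longrightarrow>
      (\<Sum>\<sigma>\<in>off_target n \<nu> \<epsilon>. spin_integral d n \<alpha> \<sigma>)
      \<le> C * real n * exp (- decay * real n * \<epsilon>\<^sup>2) * (\<Sum>\<sigma>\<in>spin_configs n. spin_integral d n \<alpha> \<sigma>)"
    and Z_pos: "\<And>n. n \<ge> 1 \<Longrightarrow> (\<Sum>\<sigma>\<in>spin_configs n. spin_integral d n \<alpha> \<sigma>) > 0"
    using off_target_weight by blast
  let ?J = "\<lambda>n \<sigma>. spin_integral d n \<alpha> \<sigma>"
  let ?ZB = "\<lambda>n B. \<Sum>\<sigma>\<in>spin_configs n. exp (B * total_spin n \<sigma>) * ?J n \<sigma>"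
  have tilt: "exp (- B * real n) \<le> exp (B * total_spin n \<sigma>)" "exp (B * total_spin n \<sigma>) \<le> exp (B * real n)"
    if "B \<ge> 0" "\<sigma> \<in> spin_configs n" for B n \<sigma>
  proof -
    have "- real n \<le> total_spin n \<sigma>" "total_spin n \<sigma> \<le> real n"
      using abs_total_spin_le[OF that(2)] by linarith+
    then have "B * (- real n) \<le> B * total_spin n \<sigma>" "B * total_spin n \<sigma> \<le> B * real n"
      using that(1) by (intro mult_left_mono; simp)+
    then show "exp (- B * real n) \<le> exp (B * total_spin n \<sigma>)" "exp (B * total_spin n \<sigma>) \<le> exp (B * real n)"
      by simp_all
  qed
  have ZB_pos: "?ZB n B > 0" if n: "n \<ge> 1" for n B
  proof -
    from Z_pos[OF n] obtain \<sigma> where \<sigma>: "\<sigma> \<in> spin_configs n" "?J n \<sigma> > 0"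
      by (metis not_le sum_nonpos)
    have "0 < exp (B * total_spin n \<sigma>) * ?J n \<sigma>" using \<sigma> by simp
    also have "\<dots> \<le> ?ZB n B"
      using \<sigma>(1) spin_integral_nonneg[OF n angle] by (intro member_le_sum) auto
    finally show ?thesis .
  qed
  show ?thesis
  proof (rule that[OF C])
    fix n :: nat assume n: "n \<ge> 1"
    note J_nonneg = spin_integral_nonneg[OF n angle]
    fix B
    show "(\<Sum>\<sigma>\<in>spin_configs n. annealed_weight d n \<beta> B \<sigma>) = 1"
      using ZB_pos[OF n, of B] by (simp add: annealed_weight_eq[OF n angle] flip: sum_divide_distrib)
    fix \<epsilon> :: real assume B: "B \<ge> 0" and \<epsilon>: "\<epsilon> \<ge> 0"
    have "(\<Sum>\<sigma>\<in>off_target n \<nu> \<epsilon>. annealed_weight d n \<beta> B \<sigma>)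
        = (\<Sum>\<sigma>\<in>off_target n \<nu> \<epsilon>. exp (B * total_spin n \<sigma>) * ?J n \<sigma>) / ?ZB n B"
      using off_target_subset[of n \<nu> \<epsilon>]
      by (simp add: annealed_weight_eq[OF n angle] subset_iff sum_divide_distrib)
    also have "\<dots> \<le> (exp (B * real n) * (\<Sum>\<sigma>\<in>off_target n \<nu> \<epsilon>. ?J n \<sigma>))
        / (exp (- B * real n) * (\<Sum>\<sigma>\<in>spin_configs n. ?J n \<sigma>))"
    proof (rule frac_le)
      show "(\<Sum>\<sigma>\<in>off_target n \<nu> \<epsilon>. exp (B * total_spin n \<sigma>) * ?J n \<sigma>)
          \<le> exp (B * real n) * (\<Sum>\<sigma>\<in>off_target n \<nu> \<epsilon>. ?J n \<sigma>)"
        unfolding sum_distrib_left using off_target_subset[of n \<nu> \<epsilon>]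
        by (intro sum_mono mult_right_mono tilt J_nonneg B) auto
      show "exp (- B * real n) * (\<Sum>\<sigma>\<in>spin_configs n. ?J n \<sigma>) \<le> ?ZB n B"
        unfolding sum_distrib_left by (intro sum_mono mult_right_mono tilt J_nonneg B) auto
      show "0 \<le> exp (B * real n) * (\<Sum>\<sigma>\<in>off_target n \<nu> \<epsilon>. ?J n \<sigma>)"
        using off_target_subset[of n \<nu> \<epsilon>] by (intro mult_nonneg_nonneg sum_nonneg J_nonneg) auto
      show "0 < exp (- B * real n) * (\<Sum>\<sigma>\<in>spin_configs n. ?J n \<sigma>)"
        using Z_pos[OF n] by simp
    qed
    also have "\<dots> \<le> (exp (B * real n) * (C * real n * exp (- decay * real n * \<epsilon>\<^sup>2) * (\<Sum>\<sigma>\<in>spin_configs n. ?J n \<sigma>)))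
        / (exp (- B * real n) * (\<Sum>\<sigma>\<in>spin_configs n. ?J n \<sigma>))"
      using Z_pos[OF n] by (intro divide_right_mono mult_left_mono off[OF n \<epsilon>]) auto
    also have "\<dots> = C * real n * (exp (B * real n) * exp (- decay * real n * \<epsilon>\<^sup>2) / exp (- B * real n))"
      using Z_pos[OF n] by simp
    also have "exp (B * real n) * exp (- decay * real n * \<epsilon>\<^sup>2) / exp (- B * real n)
        = exp ((2 * B - decay * \<epsilon>\<^sup>2) * real n)"
      by (simp add: algebra_simps flip: exp_add exp_diff)
    finally show "(\<Sum>\<sigma>\<in>off_target n \<nu> \<epsilon>. annealed_weight d n \<beta> B \<sigma>)
        \<le> C * real n * exp ((2 * B - decay * \<epsilon>\<^sup>2) * real n)" .
  qed
qed

text \<open>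
  For \<open>B < decay * \<epsilon>\<^sup>2 / 4\<close> the tilt by the field cannot compensate the exponential decay, so
  the limiting magnetization is at most \<open>\<epsilon>\<close>. Taking \<open>\<epsilon>\<close> below the supposed limit \<open>m > 0\<close> gives a contradiction.
\<close>

lemma not_spontaneously_magnetized:
  assumes "\<nu> = 0"
  shows "\<not> spontaneously_magnetized d \<beta>"
proof
  assume "spontaneously_magnetized d \<beta>"
  then obtain m where conv: "\<forall>\<^sub>F B in at_right 0. convergent (\<lambda>n. finite_magnetization d \<beta> B n)"
    and m: "m > 0" and lim: "((\<lambda>B. magnetization d \<beta> B) \<longlongrightarrow> m) (at_right 0)"
    by (auto simp: spontaneously_magnetized_def)
  obtain C where C: "C > 0" and off: "\<And>n B \<epsilon>. n \<ge> 1 \<Longrightarrow> B \<ge> 0 \<Longrightarrow> \<epsilon> \<ge> 0 \<Longrightarrow>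
      (\<Sum>\<sigma>\<in>off_target n \<nu> \<epsilon>. annealed_weight d n \<beta> B \<sigma>)
      \<le> C * real n * exp ((2 * B - decay * \<epsilon>\<^sup>2) * real n)"
    and total: "\<And>n B. n \<ge> 1 \<Longrightarrow> (\<Sum>\<sigma>\<in>spin_configs n. annealed_weight d n \<beta> B \<sigma>) = 1"
    using off_target_tilted by blast
  define \<epsilon> where "\<epsilon> = m / 2"
  have \<epsilon>: "\<epsilon> > 0" using m by (simp add: \<epsilon>_def)
  define B0 where "B0 = decay * \<epsilon>\<^sup>2 / 4"
  have B0: "B0 > 0" using decay_pos \<epsilon> by (simp add: B0_def)
  have mag_le: "magnetization d \<beta> B \<le> \<epsilon>"
    if B: "0 < B" "B < B0" and conv: "convergent (\<lambda>n. finite_magnetization d \<beta> B n)" for B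
  proof -
    have bound: "finite_magnetization d \<beta> B n \<le> \<epsilon> + C * real n * exp (- (2 * B0) * real n)"
      if n: "n \<ge> 1" for n
    proof -
      let ?w = "\<lambda>\<sigma>. annealed_weight d n \<beta> B \<sigma>"
      note w_nonneg = annealed_weight_nonneg[OF n]
      have "finite_magnetization d \<beta> B n = (\<Sum>\<sigma>\<in>spin_configs n. ?w \<sigma> * (total_spin n \<sigma> / real n))"
        unfolding finite_magnetization_def annealed_measure_def
        using w_nonneg by (subst lebesgue_integral_point_measure_finite) auto
      also have "\<dots> \<le> (\<Sum>\<sigma>\<in>spin_configs n. ?w \<sigma> * \<epsilon> + (if \<sigma> \<in> off_target n \<nu> \<epsilon> then ?w \<sigma> else 0))"
      proof (rule sum_mono)
        fix \<sigma> assume \<sigma>: "\<sigma> \<in> spin_configs n"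
        have "total_spin n \<sigma> / real n \<le> \<epsilon> + (if \<sigma> \<in> off_target n \<nu> \<epsilon> then 1 else 0)"
        proof (cases "\<sigma> \<in> off_target n \<nu> \<epsilon>")
          case True
          have "total_spin n \<sigma> / real n \<le> 1"
            using abs_total_spin_le[OF \<sigma>] n by simp
          with True \<epsilon> show ?thesis by simp
        next
          case False
          then have "\<bar>total_spin n \<sigma> / real n\<bar> \<le> \<epsilon>"
            using \<sigma> assms by (simp add: off_target_def)
          with False show ?thesis by (simp del: abs_divide)
        qed
        from mult_left_mono[OF this w_nonneg[OF \<sigma>]]
        show "?w \<sigma> * (total_spin n \<sigma> / real n) \<le> ?w \<sigma> * \<epsilon> + (if \<sigma> \<in> off_target n \<nu> \<epsilon> then ?w \<sigma> else 0)"
          by (auto simp: distrib_left split: if_splits)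
      qed
      also have "\<dots> = \<epsilon> + (\<Sum>\<sigma>\<in>off_target n \<nu> \<epsilon>. ?w \<sigma>)"
        using total[OF n, of B] off_target_subset[of n \<nu> \<epsilon>]
        by (simp add: sum.distrib sum.If_cases Int_absorb1 Int_def[symmetric] flip: sum_distrib_right)
      also have "\<dots> \<le> \<epsilon> + C * real n * exp ((2 * B - decay * \<epsilon>\<^sup>2) * real n)"
        using off[OF n, of B \<epsilon>] B \<epsilon> by simp
      also have "\<dots> \<le> \<epsilon> + C * real n * exp (- (2 * B0) * real n)"
      proof -
        have "(2 * B - decay * \<epsilon>\<^sup>2) * real n \<le> - (2 * B0) * real n"
          using B by (intro mult_right_mono) (auto simp: B0_def)
        then show ?thesis using C by (intro add_left_mono mult_left_mono) auto
      qed
      finally show ?thesis .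
    qed
    have "(\<lambda>n. finite_magnetization d \<beta> B n) \<longlonglongrightarrow> magnetization d \<beta> B"
      using conv by (simp add: magnetization_def convergent_LIMSEQ_iff)
    moreover have "(\<lambda>n. \<epsilon> + C * real n * exp (- (2 * B0) * real n)) \<longlonglongrightarrow> \<epsilon>"
      using B0 by real_asymp
    ultimately show ?thesis
      using bound by (intro LIMSEQ_le) auto
  qed
  have "\<forall>\<^sub>F B in at_right 0. magnetization d \<beta> B \<le> \<epsilon>"
    using conv eventually_at_right_real[OF B0]
    by eventually_elim (rule mag_le, auto)
  from tendsto_upperbound[OF lim this] have "m \<le> \<epsilon>"
    by simp
  with m show False by (simp add: \<epsilon>_def)
qed

text \<open>
  Once \<open>n powr (- 1 / 6) < \<nu>\<close>, the windows around \<open>\<nu>\<close> and \<open>- \<nu>\<close> are disjoint, exchanged by the spin flip, and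
  together they are the complement of \<open>off_target\<close>.
\<close>

lemma two_phase_concentration:
  assumes "\<nu> > 0"
  shows "(\<lambda>n. measure (annealed_measure d n \<beta> 0)
        {\<sigma> \<in> spin_configs n. \<bar>total_spin n \<sigma> / real n - \<nu>\<bar> \<le> real n powr (- 1 / 6)}) \<longlonglongrightarrow> 1 / 2"
    and "(\<lambda>n. measure (annealed_measure d n \<beta> 0)
        {\<sigma> \<in> spin_configs n. \<bar>total_spin n \<sigma> / real n + \<nu>\<bar> \<le> real n powr (- 1 / 6)}) \<longlonglongrightarrow> 1 / 2"
proof -
  obtain C where C: "C > 0" and off: "\<And>n B \<epsilon>. n \<ge> 1 \<Longrightarrow> B \<ge> 0 \<Longrightarrow> \<epsilon> \<ge> 0 \<Longrightarrow>
      (\<Sum>\<sigma>\<in>off_target n \<nu> \<epsilon>. annealed_weight d n \<beta> B \<sigma>)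
      \<le> C * real n * exp ((2 * B - decay * \<epsilon>\<^sup>2) * real n)"
    and total: "\<And>n B. n \<ge> 1 \<Longrightarrow> (\<Sum>\<sigma>\<in>spin_configs n. annealed_weight d n \<beta> B \<sigma>) = 1"
    using off_target_tilted by blast
  define \<epsilon> :: "nat \<Rightarrow> real" where "\<epsilon> = (\<lambda>n. real n powr (- 1 / 6))"
  define w where "w = (\<lambda>n \<sigma>. annealed_weight d n \<beta> 0 \<sigma>)"
  define P where "P = (\<lambda>n. {\<sigma> \<in> spin_configs n. \<bar>total_spin n \<sigma> / real n - \<nu>\<bar> \<le> \<epsilon> n})"
  define N where "N = (\<lambda>n. {\<sigma> \<in> spin_configs n. \<bar>total_spin n \<sigma> / real n + \<nu>\<bar> \<le> \<epsilon> n})"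
  define bad where "bad = (\<lambda>n. \<Sum>\<sigma>\<in>off_target n \<nu> (\<epsilon> n). w n \<sigma>)"
  have meas: "measure (annealed_measure d n \<beta> 0) (P n) = sum (w n) (P n)"
    "measure (annealed_measure d n \<beta> 0) (N n) = sum (w n) (N n)" if "n \<ge> 1" for n
    using that by (auto simp: P_def N_def w_def measure_annealed)
  have symmetric: "sum (w n) (N n) = sum (w n) (P n)" for n
  proof (rule sum.reindex_bij_witness[where i = "spin_flip n" and j = "spin_flip n"])
    have abs: "\<bar>- x - \<nu>\<bar> = \<bar>x + \<nu>\<bar>" "\<bar>- x + \<nu>\<bar> = \<bar>x - \<nu>\<bar>" for x by auto
    fix \<sigma>
    show "spin_flip n (spin_flip n \<sigma>) = \<sigma>" "spin_flip n \<sigma> \<in> P n" "w n (spin_flip n \<sigma>) = w n \<sigma>" if "\<sigma> \<in> N n"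
      using that by (auto simp: N_def P_def w_def spin_flip_flip spin_flip_in total_spin_flip annealed_weight_flip abs
          simp flip: minus_divide_left)
    show "spin_flip n (spin_flip n \<sigma>) = \<sigma>" "spin_flip n \<sigma> \<in> N n" if "\<sigma> \<in> P n"
      using that by (auto simp: N_def P_def spin_flip_flip spin_flip_in total_spin_flip abs
          simp flip: minus_divide_left)
  qed
  have half: "sum (w n) (P n) = (1 - bad n) / 2" if n: "n \<ge> 1" and small: "\<epsilon> n < \<nu>" for n
  proof -
    have split: "spin_configs n = P n \<union> N n \<union> off_target n \<nu> (\<epsilon> n)"
      by (auto simp: P_def N_def off_target_def)
    have disj: "P n \<inter> N n = {}" "(P n \<union> N n) \<inter> off_target n \<nu> (\<epsilon> n) = {}"
      using small by (auto simp: P_def N_def off_target_def simp del: abs_divide)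
    have fin: "finite (P n)" "finite (N n)" by (auto simp: P_def N_def)
    have "1 = sum (w n) (spin_configs n)"
      using total[OF n, of 0] by (simp add: w_def)
    also have "\<dots> = sum (w n) (P n) + sum (w n) (N n) + bad n"
      unfolding split bad_def using disj fin by (simp add: sum.union_disjoint)
    finally show ?thesis using symmetric[of n] by simp
  qed
  have "bad \<longlonglongrightarrow> 0"
  proof (rule tendsto_sandwich)
    show "\<forall>\<^sub>F n in sequentially. 0 \<le> bad n"
      using eventually_ge_at_top[of 1]
    proof eventually_elim
      case (elim n)
      then show ?case
        unfolding bad_def w_def using off_target_subset[of n \<nu> "\<epsilon> n"]
        by (intro sum_nonneg annealed_weight_nonneg) auto
    qed
    show "\<forall>\<^sub>F n in sequentially. bad n \<le> C * real n * exp (- (decay * (real n powr (- 1 / 6))\<^sup>2 * real n))"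
      using eventually_ge_at_top[of 1]
    proof eventually_elim
      case (elim n)
      then show ?case
        using off[of n 0 "\<epsilon> n"] by (simp add: bad_def w_def \<epsilon>_def)
    qed
    show "(\<lambda>n. C * real n * exp (- (decay * (real n powr (- 1 / 6))\<^sup>2 * real n))) \<longlonglongrightarrow> 0"
      using decay_pos by real_asymp
  qed simp
  then have "(\<lambda>n. (1 - bad n) / 2) \<longlonglongrightarrow> (1 - 0) / 2"
    by (intro tendsto_intros) auto
  then have lim: "(\<lambda>n. (1 - bad n) / 2) \<longlonglongrightarrow> 1 / 2" by simp
  have "\<epsilon> \<longlonglongrightarrow> 0" unfolding \<epsilon>_def by real_asymp
  then have "\<forall>\<^sub>F n in sequentially. \<epsilon> n < \<nu>"
    using assms by (rule order_tendstoD)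
  then have ev: "\<forall>\<^sub>F n in sequentially. n \<ge> 1 \<and> \<epsilon> n < \<nu>"
    using eventually_ge_at_top[of 1] by eventually_elim simp
  have "(\<lambda>n. measure (annealed_measure d n \<beta> 0) (P n)) \<longlonglongrightarrow> 1 / 2"
    using lim by (rule Lim_transform_eventually) (use ev in eventually_elim, simp add: meas half)
  then show "(\<lambda>n. measure (annealed_measure d n \<beta> 0)
        {\<sigma> \<in> spin_configs n. \<bar>total_spin n \<sigma> / real n - \<nu>\<bar> \<le> real n powr (- 1 / 6)}) \<longlonglongrightarrow> 1 / 2"
    by (simp add: P_def \<epsilon>_def)
  have "(\<lambda>n. measure (annealed_measure d n \<beta> 0) (N n)) \<longlonglongrightarrow> 1 / 2"
    using lim by (rule Lim_transform_eventually) (use ev in eventually_elim, simp add: meas symmetric half)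
  then show "(\<lambda>n. measure (annealed_measure d n \<beta> 0)
        {\<sigma> \<in> spin_configs n. \<bar>total_spin n \<sigma> / real n + \<nu>\<bar> \<le> real n powr (- 1 / 6)}) \<longlonglongrightarrow> 1 / 2"
    by (simp add: N_def \<epsilon>_def)
qed

end

lemma subcritical_not_spontaneously_magnetized:
  assumes "d \<ge> 2" "\<beta> > 0" "(real d - 1) * (1 - exp (- 2 * \<beta>)) < 1 + exp (- 2 * \<beta>)"
  shows "\<not> spontaneously_magnetized d \<beta>"
proof -
  have q: "0 < exp (- 2 * \<beta>)" "exp (- 2 * \<beta>) < 1" using assms(2) by auto
  obtain c where c: "c > 0"
    "\<And>w. 0 \<le> w \<Longrightarrow> w \<le> 1 \<Longrightarrow> rate (exp (- 2 * \<beta>)) d w \<le> rate (exp (- 2 * \<beta>)) d 0 - c * w\<^sup>2"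
    using rate_max_subcritical[OF q assms(1,3)] by blast
  then have "\<exists>\<alpha> \<kappa> t0. spin_landscape d \<beta> \<alpha> (bias d 0) \<kappa> t0"
    using assms by (intro spin_landscapeI[where c = c]) auto
  then show ?thesis
    using spin_landscape.not_spontaneously_magnetized by (auto simp: bias_def)
qed

theorem proposition1p4:
  fixes d :: nat and \<beta> :: real
  assumes "d \<ge> 2"
    and "ereal \<beta> > critical_beta d"
  shows "\<exists>\<nu>::real. \<nu> > 0 \<and>
    ((\<lambda>n::nat. measure (annealed_measure d n \<beta> 0)
        {\<sigma> \<in> spin_configs n. \<bar>total_spin n \<sigma> / real n - \<nu>\<bar> \<le> real n powr (- 1 / 6)})
      \<longlonglongrightarrow> 1 / 2) \<and>
    ((\<lambda>n::nat. measure (annealed_measure d n \<beta> 0)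
        {\<sigma> \<in> spin_configs n. \<bar>total_spin n \<sigma> / real n + \<nu>\<bar> \<le> real n powr (- 1 / 6)})
      \<longlonglongrightarrow> 1 / 2)"
proof -
  obtain \<beta>' where \<beta>': "\<beta>' > 0" "spontaneously_magnetized d \<beta>'" "\<beta>' < \<beta>"
    using assms(2) by (auto simp: critical_beta_def Inf_less_iff)
  define q where "q = exp (- 2 * \<beta>)"
  define q' where "q' = exp (- 2 * \<beta>')"
  have q: "0 < q" "q < q'" "q' < 1"
    using \<beta>' by (auto simp: q_def q'_def)
  have "(real d - 1) * (1 - q') \<ge> 1 + q'"
    using subcritical_not_spontaneously_magnetized[OF assms(1) \<beta>'(1)] \<beta>'(2)
    unfolding q'_def by (meson not_less)
  moreover have "(real d - 1) * (1 - q) \<ge> (real d - 1) * (1 - q')"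
    using assms(1) q by (intro mult_left_mono) auto
  ultimately have super: "(real d - 1) * (1 - q) > 1 + q"
    using q by linarith
  obtain u c where u: "0 < u" "u < 1" "c > 0"
    and max: "\<And>w. 0 \<le> w \<Longrightarrow> w \<le> 1 \<Longrightarrow> rate q d w \<le> rate q d u - c * (w - u)\<^sup>2"
    using rate_max_supercritical[OF q(1) _ assms(1) super] q by (metis less_trans)
  have "\<exists>\<alpha> \<kappa> t0. spin_landscape d \<beta> \<alpha> (bias d u) \<kappa> t0"
    using assms(1) \<beta>' u max by (intro spin_landscapeI[where c = c]) (auto simp: q_def)
  then obtain \<alpha> \<kappa> t0 where "spin_landscape d \<beta> \<alpha> (bias d u) \<kappa> t0"
    by blast
  then interpret spin_landscape d \<beta> \<alpha> "bias d u" \<kappa> t0 .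
  have "bias d u > 0"
    using assms(1) u by (intro bias_pos) auto
  with two_phase_concentration show ?thesis by blast
qed

end
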